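(* Let $K$ be a skew field (with the discrete topology), let $G$ and $H$ be sets with involutions $*$, let $\mathfrak{G}$ be a balanced filter on $G$ and $\mathfrak{H}$ a balanced filter on $H$, and let $\Phi$ be an $H\times G$-matrix over $K$. Then the following are equivalent. a) The left multiplication $\mathbf{a}\mapsto\Phi\cdot\mathbf{a}$ defines a continuous linear map $\phi$ from $\{\mathfrak{G}\}K$ to $\{\mathfrak{H}\}K$ (with respect to the topologies $T(\mathfrak{G})$ and $T(\mathfrak{H})$). b) The zero set $\mathcal{Z}(\Phi)$ belongs to the filter $\langle \mathfrak{H},\mathfrak{G}^{\perp *}\rangle$. c) Each row $\Phi_h$, $h\in H$, belongs to $K\{\mathfrak{G}^{\perp *}\}$; furthermore, for every $A\in\mathfrak{G}$ the family of columns $\Phi^{t^*}$, $t\in\overline{A}$, is $\mathfrak{H}$-summable and $$\Phi\cdot\Bigl(\sum_{t\in\overline{A}}{}^{\mathrm{Tych}}\,\delta^t k_t\Bigr)=\sum_{t\in\overline{A}}{}^{\mathfrak{H}}\,\Phi^{t^*}k_t$$ for any set of coefficients $k_t\in K$ ($t\in\overline{A}$). d) The left multiplication $\mathbf{a}\mapsto\Phi\cdot\mathbf{a}$ defines a $\mathfrak{G}$-linear map $\phi$ from $\{\mathfrak{G}\}K$ to $\{\mathfrak{H}\}K$. Moreover, if $\phi$ is a linear continuous map from $\{\mathfrak{G}\}K$ to $\{\mathfrak{H}\}K$, then its matrix $\Phi$ satisfies these equivalent conditions.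
   Context: Filters. A filter on a set $S$ is a nonempty collection of subsets of $S$ closed under finite intersections and supersets (the collection $\mathcal{P}(S)$ of all subsets is allowed). $\overline{A}$ denotes the complement of $A$ in the ambient set. For a filter $\mathfrak{F}$ on $S$, $\mathfrak{F}^{\perp}=\{A\subseteq S\mid A\cup A' \text{ is cofinite in } S \text{ for every } A'\in\mathfrak{F}\}$; this is a filter. $\mathfrak{F}$ is balanced if $\mathfrak{F}^{\perp\perp}=\mathfrak{F}$. (A balanced filter contains all cofinite sets.) An involution on $S$ is a map $*:S\to S$ with $s^{**}=s$; $A^*=\{a^*\mid a\in A\}$, $\mathfrak{F}^*=\{A^*\mid A\in\mathfrak{F}\}$, and $\mathfrak{F}^{\perp *}=(\mathfrak{F}^{\perp})^*$. For filters $\mathfrak{H}$ on $H$ and $\mathfrak{F}$ on $G$, $\langle\mathfrak{H},\mathfrak{F}\rangle$ is the filter on $H\times G$ of all $X\subseteq H\times G$ such that: for every $A\in\mathfrak{F}^{\perp}$ there is $B'\in\mathfrak{H}$ with $B'\times\overline{A}\subseteq X$; and for every $B\in\mathfrak{H}^{\perp}$ there is $A'\in\mathfrak{F}$ with $\overline{B}\times A'\subseteq X$. Spaces. For $f:S\to K$, $\mathcal{Z}(f)=\{s\mid f(s)=0\}$ and $\mathrm{supp}(f)=\{s\mid f(s)\ne 0\}$. For a filter $\mathfrak{F}$ on $S$, $\mathrm{Funct}(\mathfrak{F})=\{f:S\to K\mid \mathcal{Z}(f)\in\mathfrak{F}\}$. Considered as a left $K$-vector space (of rows) it is denoted $K\{\mathfrak{F}\}$;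 considered as a right $K$-vector space (of columns) it is denoted $\{\mathfrak{F}\}K$. The topology $T(\mathfrak{F})$ on $\mathrm{Funct}(\mathfrak{F})$ is the linear topology having as a base of neighbourhoods of zero the subspaces $U(A,\mathfrak{F})=\{f\in\mathrm{Funct}(\mathfrak{F})\mid \mathrm{supp}(f)\subseteq A\}$, $A\in\mathfrak{F}^{\perp}$. Summability. A family $h_j:S\to K$, $j\in J$, is $\mathfrak{F}$-summable with $\mathfrak{F}$-sum $f=\sum_{j\in J}^{\mathfrak{F}}h_j$ if (1) for every $s\in S$ there are only finitely many $j$ with $h_j(s)\neq 0$, and $f(s)=\sum_{j}h_j(s)$; (2) $\bigcap_{j\in J}\mathcal{Z}(h_j)\in\mathfrak{F}$. The sum $\sum^{\mathrm{Tych}}$ is the sum with respect to the Tychonoff topology (pointwise convergence with $K$ discrete), i.e. it is defined by condition (1) alone. A (right) linear map $\phi:\{\mathfrak{G}\}K\to\{\mathfrak{H}\}K$ is $\mathfrak{G}$-linear if for any $\mathfrak{G}$-summable family $h_j\in\mathrm{Funct}(\mathfrak{G})$, $j\in J$, the family $\phi[h_j]$, $j\in J$, is $\mathfrak{H}$-summable and $\phi\bigl[\sum_{j\in J}^{\mathfrak{G}}h_j\bigr]=\sum_{j\in J}^{\mathfrak{H}}\phi[h_j]$. Matrices. An $H\times G$-matrix is a map $\Phi:H\times G\to K$, with $(h,g)$-entry $\Phi_h^g$; $\mathcal{Z}(\Phi)=\{(h,g)\mid\Phi^g_h=0\}$; $\Phi_h$ is the row $g\mapsto\Phi_h^g$ and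 $\Phi^g$ the column $h\mapsto\Phi_h^g$. For a column $\mathbf{a}=(a_g)_{g\in G}$ the product $\Phi\cdot\mathbf{a}$ is the column with $(\Phi\cdot\mathbf{a})_h=\sum_{g\in G}\Phi_h^{g^*}a_g$; it is defined if for every $h$ only finitely many summands are nonzero. $\delta^g$ is the column on $G$ with $g$-th coordinate $1$ and all other coordinates $0$. The matrix $\Phi$ of a map $\phi:\{\mathfrak{G}\}K\to\{\mathfrak{H}\}K$ is given by $\Phi_h^{g^*}=\phi[\delta^g]_h$. *)

theory Defs
  imports "HOL-Analysis.Abstract_Topology"
begin

text \<open>
  The underlying sets are carriers \<open>S :: 'a set\<close> (possibly empty), and a filter on \<open>S\<close> is a
  family of subsets of \<open>S\<close>; the improper filter \<open>Pow S\<close> is allowed.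
\<close>

definition filter_on :: "'a set \<Rightarrow> 'a set set \<Rightarrow> bool" where
  "filter_on S F \<longleftrightarrow> F \<subseteq> Pow S \<and> F \<noteq> {} \<and>
     (\<forall>A\<in>F. \<forall>B\<in>F. A \<inter> B \<in> F) \<and> (\<forall>A\<in>F. \<forall>B. A \<subseteq> B \<and> B \<subseteq> S \<longrightarrow> B \<in> F)"

definition perp :: "'a set \<Rightarrow> 'a set set \<Rightarrow> 'a set set" where
  "perp S F = {A. A \<subseteq> S \<and> (\<forall>A'\<in>F. finite (S - (A \<union> A')))}"

definition balanced :: "'a set \<Rightarrow> 'a set set \<Rightarrow> bool" where
  "balanced S F \<longleftrightarrow> filter_on S F \<and> perp S (perp S F) = F"

definition involution_on :: "'a set \<Rightarrow> ('a \<Rightarrow> 'a) \<Rightarrow> bool" where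
  "involution_on S \<sigma> \<longleftrightarrow> \<sigma> \<in> S \<rightarrow> S \<and> (\<forall>s\<in>S. \<sigma> (\<sigma> s) = s)"

definition star_filter :: "('a \<Rightarrow> 'a) \<Rightarrow> 'a set set \<Rightarrow> 'a set set" where
  "star_filter \<sigma> F = (\<lambda>A. \<sigma> ` A) ` F"

definition pair_filter ::
    "'h set \<Rightarrow> 'h set set \<Rightarrow> 'g set \<Rightarrow> 'g set set \<Rightarrow> ('h \<times> 'g) set set" where
  "pair_filter H \<HH> G \<FF> = {X. X \<subseteq> H \<times> G \<and>
     (\<forall>A\<in>perp G \<FF>. \<exists>B'\<in>\<HH>. B' \<times> (G - A) \<subseteq> X) \<and>
     (\<forall>B\<in>perp H \<HH>. \<exists>A'\<in>\<FF>. (H - B) \<times> A' \<subseteq> X)}"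

lemma perp_Int:
  assumes "A \<in> perp S F" "B \<in> perp S F"
  shows "A \<inter> B \<in> perp S F"
proof -
  have "finite (S - (A \<inter> B \<union> C))" if "C \<in> F" for C
  proof (rule finite_subset)
    show "S - (A \<inter> B \<union> C) \<subseteq> (S - (A \<union> C)) \<union> (S - (B \<union> C))" by auto
    show "finite ((S - (A \<union> C)) \<union> (S - (B \<union> C)))" using assms that by (simp add: perp_def)
  qed
  then show ?thesis using assms by (auto simp: perp_def)
qed

lemma perp_superset:
  assumes "A \<in> perp S F" "A \<subseteq> B" "B \<subseteq> S"
  shows "B \<in> perp S F"
proof -
  have "finite (S - (B \<union> C))" if "C \<in> F" for C
  proof (rule finite_subset)
    show "S - (B \<union> C) \<subseteq> S - (A \<union> C)" using assms(2) by auto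
    show "finite (S - (A \<union> C))" using assms that by (simp add: perp_def)
  qed
  then show ?thesis using assms by (auto simp: perp_def)
qed

lemma filter_on_perp: "filter_on S (perp S F)"
proof -
  have eq: "S - (S \<union> C) = {}" for C by auto
  have "S \<in> perp S F" by (simp add: perp_def eq)
  then have "perp S F \<noteq> {}" by blast
  moreover have "perp S F \<subseteq> Pow S" by (auto simp: perp_def)
  ultimately show ?thesis
    unfolding filter_on_def using perp_Int perp_superset by metis
qed

text \<open>
  A function \<open>S \<rightarrow> K\<close> is represented by its extension by zero to the whole type, so that
  pointwise operations on the representatives are the operations on functions on \<open>S\<close>.
  The skew field \<open>K\<close> is a type of class \<^class>\<open>division_ring\<close>.
\<close>

definition functions_on :: "'a set \<Rightarrow> ('a \<Rightarrow> 'k::zero) set" where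
  "functions_on S = {f. \<forall>s. s \<notin> S \<longrightarrow> f s = 0}"

definition zero_set :: "'a set \<Rightarrow> ('a \<Rightarrow> 'k::zero) \<Rightarrow> 'a set" where
  "zero_set S f = {s\<in>S. f s = 0}"

definition supp :: "'a set \<Rightarrow> ('a \<Rightarrow> 'k::zero) \<Rightarrow> 'a set" where
  "supp S f = {s\<in>S. f s \<noteq> 0}"

text \<open>The common underlying set of \<open>K{F}\<close> (rows) and \<open>{F}K\<close> (columns).\<close>

definition Funct :: "'a set \<Rightarrow> 'a set set \<Rightarrow> ('a \<Rightarrow> 'k::zero) set" where
  "Funct S F = {f \<in> functions_on S. zero_set S f \<in> F}"

definition basic_nhd :: "'a set \<Rightarrow> 'a set set \<Rightarrow> 'a set \<Rightarrow> ('a \<Rightarrow> 'k::zero) set" where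
  "basic_nhd S F A = {f \<in> Funct S F. supp S f \<subseteq> A}"

text \<open>
  A set is open iff with each of its points \<open>f\<close> it contains a translate \<open>f + U(A,F)\<close>.
\<close>

definition filter_topology :: "'a set \<Rightarrow> 'a set set \<Rightarrow> ('a \<Rightarrow> 'k::division_ring) topology" where
  "filter_topology S F = topology (\<lambda>V. V \<subseteq> Funct S F \<and>
     (\<forall>f\<in>V. \<exists>A\<in>perp S F. (\<lambda>u s. f s + u s) ` basic_nhd S F A \<subseteq> V))"

lemma openin_filter_topology:
  fixes V :: "('a \<Rightarrow> 'k::division_ring) set"
  shows "openin (filter_topology S F) V \<longleftrightarrow> V \<subseteq> Funct S F \<and>
     (\<forall>f\<in>V. \<exists>A\<in>perp S F. (\<lambda>u s. f s + u s) ` basic_nhd S F A \<subseteq> V)"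
proof -
  let ?P = "\<lambda>V :: ('a \<Rightarrow> 'k) set. V \<subseteq> Funct S F \<and>
     (\<forall>f\<in>V. \<exists>A\<in>perp S F. (\<lambda>u s. f s + u s) ` basic_nhd S F A \<subseteq> V)"
  have "istopology ?P"
    unfolding istopology_def
  proof (intro conjI allI impI)
    fix V W :: "('a \<Rightarrow> 'k) set" assume V: "?P V" and W: "?P W"
    show "V \<inter> W \<subseteq> Funct S F" using V by blast
    show "\<forall>f\<in>V \<inter> W. \<exists>A\<in>perp S F. (\<lambda>u s. f s + u s) ` basic_nhd S F A \<subseteq> V \<inter> W"
    proof
      fix f assume f: "f \<in> V \<inter> W"
      obtain A B where AB: "A \<in> perp S F" "(\<lambda>u s. f s + u s) ` basic_nhd S F A \<subseteq> V"
          "B \<in> perp S F" "(\<lambda>u s. f s + u s) ` basic_nhd S F B \<subseteq> W"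
        using V W f by blast
      have "basic_nhd S F (A \<inter> B) \<subseteq> (basic_nhd S F A :: ('a \<Rightarrow> 'k) set)"
           "basic_nhd S F (A \<inter> B) \<subseteq> (basic_nhd S F B :: ('a \<Rightarrow> 'k) set)"
        by (auto simp: basic_nhd_def)
      then have "(\<lambda>u s. f s + u s) ` basic_nhd S F (A \<inter> B) \<subseteq> V \<inter> W" using AB by blast
      then show "\<exists>A\<in>perp S F. (\<lambda>u s. f s + u s) ` basic_nhd S F A \<subseteq> V \<inter> W"
        using perp_Int[OF AB(1,3)] by blast
    qed
  next
    fix \<V> :: "('a \<Rightarrow> 'k) set set" assume P: "\<forall>V\<in>\<V>. ?P V"
    show "\<Union>\<V> \<subseteq> Funct S F" using P by blast
    show "\<forall>f\<in>\<Union>\<V>. \<exists>A\<in>perp S F. (\<lambda>u s. f s + u s) ` basic_nhd S F A \<subseteq> \<Union>\<V>"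
    proof
      fix f assume "f \<in> \<Union>\<V>"
      then obtain V where V: "V \<in> \<V>" "f \<in> V" by blast
      then obtain A where "A \<in> perp S F" "(\<lambda>u s. f s + u s) ` basic_nhd S F A \<subseteq> V"
        using P by blast
      then show "\<exists>A\<in>perp S F. (\<lambda>u s. f s + u s) ` basic_nhd S F A \<subseteq> \<Union>\<V>"
        using V by blast
    qed
  qed
  then show ?thesis by (simp add: filter_topology_def topology_inverse')
qed

lemma Funct_add:
  fixes f g :: "'a \<Rightarrow> 'k::division_ring"
  assumes "filter_on S F" "f \<in> Funct S F" "g \<in> Funct S F"
  shows "(\<lambda>s. f s + g s) \<in> Funct S F"
proof -
  have "zero_set S f \<inter> zero_set S g \<in> F" using assms by (auto simp: filter_on_def Funct_def)
  moreover have "zero_set S f \<inter> zero_set S g \<subseteq> zero_set S (\<lambda>s. f s + g s)"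
    by (auto simp: zero_set_def)
  moreover have "zero_set S (\<lambda>s. f s + g s) \<subseteq> S" by (auto simp: zero_set_def)
  ultimately have "zero_set S (\<lambda>s. f s + g s) \<in> F"
    using assms(1) unfolding filter_on_def by blast
  then show ?thesis using assms by (auto simp: Funct_def functions_on_def)
qed

lemma topspace_filter_topology:
  assumes "filter_on S F"
  shows "topspace (filter_topology S F) = (Funct S F :: ('a \<Rightarrow> 'k::division_ring) set)"
proof -
  obtain A where A: "A \<in> perp S F" using filter_on_perp[of S F] by (auto simp: filter_on_def)
  have "(\<lambda>u s. f s + u s) ` basic_nhd S F A \<subseteq> Funct S F"
    if "f \<in> Funct S F" for f :: "'a \<Rightarrow> 'k"
    using Funct_add[OF assms that] by (auto simp: basic_nhd_def)
  then have "openin (filter_topology S F) (Funct S F :: ('a \<Rightarrow> 'k) set)"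
    unfolding openin_filter_topology using A by blast
  moreover have "topspace (filter_topology S F) \<subseteq> (Funct S F :: ('a \<Rightarrow> 'k) set)"
    using openin_topspace[of "filter_topology S F :: ('a \<Rightarrow> 'k) topology"]
    unfolding openin_filter_topology by (rule conjunct1)
  ultimately show ?thesis using openin_subset by blast
qed

lemma openin_basic_nhd:
  assumes "filter_on S F" "A \<in> perp S F"
  shows "openin (filter_topology S F) (basic_nhd S F A :: ('a \<Rightarrow> 'k::division_ring) set)"
proof -
  have "(\<lambda>s. f s + u s) \<in> basic_nhd S F A"
    if f: "f \<in> basic_nhd S F A" and u: "u \<in> basic_nhd S F A" for f u :: "'a \<Rightarrow> 'k"
  proof -
    have "supp S (\<lambda>s. f s + u s) \<subseteq> supp S f \<union> supp S u" by (auto simp: supp_def)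
    then show ?thesis using f u Funct_add[OF assms(1), of f u] by (auto simp: basic_nhd_def)
  qed
  then have "(\<lambda>u s. f s + u s) ` basic_nhd S F A \<subseteq> basic_nhd S F A"
    if "f \<in> basic_nhd S F A" for f :: "'a \<Rightarrow> 'k" using that by blast
  moreover have "basic_nhd S F A \<subseteq> (Funct S F :: ('a \<Rightarrow> 'k) set)" by (auto simp: basic_nhd_def)
  ultimately show ?thesis
    unfolding openin_filter_topology using assms(2) by blast
qed

definition has_tych_sum ::
    "'s set \<Rightarrow> 'j set \<Rightarrow> ('j \<Rightarrow> 's \<Rightarrow> 'k::division_ring) \<Rightarrow> ('s \<Rightarrow> 'k) \<Rightarrow> bool" where
  "has_tych_sum S J h f \<longleftrightarrow> (\<forall>j\<in>J. h j \<in> functions_on S) \<and> f \<in> functions_on S \<and>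
     (\<forall>s\<in>S. finite {j\<in>J. h j s \<noteq> 0} \<and> f s = (\<Sum>j\<in>{j\<in>J. h j s \<noteq> 0}. h j s))"

text \<open>
  The set of common zeros is written as a comprehension, so that it is \<open>S\<close> for \<open>J = {}\<close>.
\<close>

definition has_filter_sum ::
    "'s set \<Rightarrow> 's set set \<Rightarrow> 'j set \<Rightarrow> ('j \<Rightarrow> 's \<Rightarrow> 'k::division_ring) \<Rightarrow> ('s \<Rightarrow> 'k) \<Rightarrow> bool" where
  "has_filter_sum S F J h f \<longleftrightarrow> has_tych_sum S J h f \<and> {s\<in>S. \<forall>j\<in>J. s \<in> zero_set S (h j)} \<in> F"

definition filter_summable ::
    "'s set \<Rightarrow> 's set set \<Rightarrow> 'j set \<Rightarrow> ('j \<Rightarrow> 's \<Rightarrow> 'k::division_ring) \<Rightarrow> bool" where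
  "filter_summable S F J h \<longleftrightarrow> (\<exists>f. has_filter_sum S F J h f)"

definition right_linear ::
    "'g set \<Rightarrow> 'g set set \<Rightarrow> 'h set \<Rightarrow> 'h set set \<Rightarrow>
     (('g \<Rightarrow> 'k::division_ring) \<Rightarrow> ('h \<Rightarrow> 'k)) \<Rightarrow> bool" where
  "right_linear G \<GG> H \<HH> \<phi> \<longleftrightarrow> \<phi> \<in> Funct G \<GG> \<rightarrow> Funct H \<HH> \<and>
     (\<forall>a\<in>Funct G \<GG>. \<forall>b\<in>Funct G \<GG>. \<phi> (\<lambda>g. a g + b g) = (\<lambda>h. \<phi> a h + \<phi> b h)) \<and>
     (\<forall>a\<in>Funct G \<GG>. \<forall>k. \<phi> (\<lambda>g. a g * k) = (\<lambda>h. \<phi> a h * k))"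

text \<open>
  HOL cannot quantify over all index sets at once: here \<open>J\<close> ranges over all subsets of the
  type \<open>'j\<close> passed as the first argument. The notion for all index sets is the conjunction over
  all types \<open>'j\<close>. By linearity the zero members of a family do not matter, and a summable family
  has at most \<open>|G \<times> nat|\<close> nonzero members, so \<open>'j = 'g \<times> nat\<close> is already the strongest instance.
\<close>

definition filter_linear ::
    "'j itself \<Rightarrow> 'g set \<Rightarrow> 'g set set \<Rightarrow> 'h set \<Rightarrow> 'h set set \<Rightarrow>
     (('g \<Rightarrow> 'k::division_ring) \<Rightarrow> ('h \<Rightarrow> 'k)) \<Rightarrow> bool" where
  "filter_linear _ G \<GG> H \<HH> \<phi> \<longleftrightarrow> right_linear G \<GG> H \<HH> \<phi> \<and>
     (\<forall>(J :: 'j set) h f. (\<forall>j\<in>J. h j \<in> Funct G \<GG>) \<and> has_filter_sum G \<GG> J h f \<longrightarrow>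
        has_filter_sum H \<HH> J (\<lambda>j. \<phi> (h j)) (\<phi> f))"

definition delta :: "'g \<Rightarrow> 'g \<Rightarrow> 'k::division_ring" where
  "delta g = (\<lambda>x. if x = g then 1 else 0)"

text \<open>
  An \<open>H \<times> G\<close>-matrix is an element \<open>\<Phi>\<close> of \<open>functions_on (H \<times> G)\<close>, with \<open>\<Phi> (h, g)\<close> the
  \<open>(h, g)\<close>-entry.
\<close>

definition mult_defined ::
    "'h set \<Rightarrow> 'g set \<Rightarrow> ('g \<Rightarrow> 'g) \<Rightarrow> ('h \<times> 'g \<Rightarrow> 'k::division_ring) \<Rightarrow> ('g \<Rightarrow> 'k) \<Rightarrow> bool" where
  "mult_defined H G \<sigma> \<Phi> a \<longleftrightarrow> (\<forall>h\<in>H. finite {g\<in>G. \<Phi> (h, \<sigma> g) * a g \<noteq> 0})"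

definition mat_mult ::
    "'g set \<Rightarrow> ('g \<Rightarrow> 'g) \<Rightarrow> ('h \<times> 'g \<Rightarrow> 'k::division_ring) \<Rightarrow> ('g \<Rightarrow> 'k) \<Rightarrow> ('h \<Rightarrow> 'k)" where
  "mat_mult G \<sigma> \<Phi> a =
     (\<lambda>h. \<Sum>g\<in>{g\<in>G. \<Phi> (h, \<sigma> g) * a g \<noteq> 0}. \<Phi> (h, \<sigma> g) * a g)"

text \<open>
  \<open>\<Phi>\<^sub>h\<^bsup>g*\<^esup> = \<phi>[\<delta>\<^bsup>g\<^esup>]\<^sub>h\<close>, solved for \<open>\<Phi>\<^sub>h\<^bsup>g\<^esup>\<close>.
\<close>

definition matrix_of ::
    "'h set \<Rightarrow> 'g set \<Rightarrow> ('g \<Rightarrow> 'g) \<Rightarrow> (('g \<Rightarrow> 'k::division_ring) \<Rightarrow> ('h \<Rightarrow> 'k)) \<Rightarrow> 'h \<times> 'g \<Rightarrow> 'k" where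
  "matrix_of H G \<sigma> \<phi> =
     (\<lambda>(h, g). if h \<in> H \<and> g \<in> G then \<phi> (delta (\<sigma> g)) h else 0)"

definition mult_defines_map ::
    "'g set \<Rightarrow> ('g \<Rightarrow> 'g) \<Rightarrow> 'g set set \<Rightarrow> 'h set \<Rightarrow> 'h set set \<Rightarrow>
     ('h \<times> 'g \<Rightarrow> 'k::division_ring) \<Rightarrow> bool" where
  "mult_defines_map G \<sigma> \<GG> H \<HH> \<Phi> \<longleftrightarrow>
     (\<forall>a\<in>Funct G \<GG>. mult_defined H G \<sigma> \<Phi> a \<and> mat_mult G \<sigma> \<Phi> a \<in> Funct H \<HH>)"

definition mult_continuous_linear ::
    "'g set \<Rightarrow> ('g \<Rightarrow> 'g) \<Rightarrow> 'g set set \<Rightarrow> 'h set \<Rightarrow> 'h set set \<Rightarrow>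
     ('h \<times> 'g \<Rightarrow> 'k::division_ring) \<Rightarrow> bool" where
  "mult_continuous_linear G \<sigma> \<GG> H \<HH> \<Phi> \<longleftrightarrow>
     mult_defines_map G \<sigma> \<GG> H \<HH> \<Phi> \<and>
     right_linear G \<GG> H \<HH> (mat_mult G \<sigma> \<Phi>) \<and>
     continuous_map (filter_topology G \<GG>) (filter_topology H \<HH>) (mat_mult G \<sigma> \<Phi>)"

definition zero_set_in_pair_filter ::
    "'g set \<Rightarrow> ('g \<Rightarrow> 'g) \<Rightarrow> 'g set set \<Rightarrow> 'h set \<Rightarrow> 'h set set \<Rightarrow>
     ('h \<times> 'g \<Rightarrow> 'k::division_ring) \<Rightarrow> bool" where
  "zero_set_in_pair_filter G \<sigma> \<GG> H \<HH> \<Phi> \<longleftrightarrow>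
     zero_set (H \<times> G) \<Phi> \<in> pair_filter H \<HH> G (star_filter \<sigma> (perp G \<GG>))"

definition rows_and_columns_summable ::
    "'g set \<Rightarrow> ('g \<Rightarrow> 'g) \<Rightarrow> 'g set set \<Rightarrow> 'h set \<Rightarrow> 'h set set \<Rightarrow>
     ('h \<times> 'g \<Rightarrow> 'k::division_ring) \<Rightarrow> bool" where
  "rows_and_columns_summable G \<sigma> \<GG> H \<HH> \<Phi> \<longleftrightarrow>
     (\<forall>h\<in>H. (\<lambda>g. \<Phi> (h, g)) \<in> Funct G (star_filter \<sigma> (perp G \<GG>))) \<and>
     (\<forall>A\<in>\<GG>. filter_summable H \<HH> (G - A) (\<lambda>t h. \<Phi> (h, \<sigma> t)) \<and>
        (\<forall>k :: 'g \<Rightarrow> 'k. \<exists>a. has_tych_sum G (G - A) (\<lambda>t g. delta t g * k t) a \<and>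
           mult_defined H G \<sigma> \<Phi> a \<and>
           has_filter_sum H \<HH> (G - A) (\<lambda>t h. \<Phi> (h, \<sigma> t) * k t) (mat_mult G \<sigma> \<Phi> a)))"

definition mult_filter_linear ::
    "'j itself \<Rightarrow> 'g set \<Rightarrow> ('g \<Rightarrow> 'g) \<Rightarrow> 'g set set \<Rightarrow> 'h set \<Rightarrow> 'h set set \<Rightarrow>
     ('h \<times> 'g \<Rightarrow> 'k::division_ring) \<Rightarrow> bool" where
  "mult_filter_linear I G \<sigma> \<GG> H \<HH> \<Phi> \<longleftrightarrow>
     mult_defines_map G \<sigma> \<GG> H \<HH> \<Phi> \<and> filter_linear I G \<GG> H \<HH> (mat_mult G \<sigma> \<Phi>)"

end

theory Submission
  imports Defs
begin

text \<open>
  Write \<open>\<Psi>(h, g) = \<Phi>(h, \<sigma> g)\<close>, so that \<open>\<Phi> \<cdot> a\<close> is the ordinary product of \<open>\<Psi>\<close> with the column \<open>a\<close>.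
  In these terms the zero set condition consists of two statements about rectangles:

  \<^item> for every \<open>A \<in> \<GG>\<close> the columns of \<open>\<Psi>\<close> outside \<open>A\<close> vanish together on some \<open>B \<in> \<HH>\<close>;
  \<^item> for every \<open>B \<in> \<HH>\<^sup>\<bottom>\<close> the rows of \<open>\<Psi>\<close> outside \<open>B\<close> vanish together on some \<open>A \<in> \<GG>\<^sup>\<bottom>\<close>.

  The first says that columns supported off \<open>A\<close> have products supported off \<open>B\<close>, the second is the
  continuity of the multiplication at zero. Each row lies in \<open>Funct(\<GG>\<^sup>\<bottom>)\<close> by the second
  statement, and a support of \<open>Funct(\<GG>)\<close> meets a support of \<open>Funct(\<GG>\<^sup>\<bottom>)\<close> in a finite set. Hence
  every entry of a product is a finite sum, and so is every entry of the image of a summable family;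
  exchanging two finite sums shows that the multiplication respects filter sums.

  The key to the converse directions is that each of the two statements follows from the other as
  soon as the single columns (respectively rows) have their zero sets in the right filter
  (\<open>vanishes_on_rectangles_transpose\<close>). To show that a set \<open>B\<close> lies in the balanced filter
  \<open>\<HH> = \<HH>\<^sup>\<bottom>\<^sup>\<bottom>\<close>, one compares it with an arbitrary \<open>C \<in> \<HH>\<^sup>\<bottom>\<close>. Among the columns outside \<open>A\<close> only
  those with index in some finite set \<open>G - (A \<union> A')\<close> can be nonzero outside \<open>C\<close>, and each of them is
  nonzero at only finitely many places outside \<open>C\<close>. A continuous linear map, evaluated at the \<open>\<delta>\<^sup>g\<close>,
  gives the second statement and the single columns. The condition on rows and columns contains the
  first statement and the single rows, and it follows from compatibility with filter sums, applied to
  the families \<open>\<delta>\<^sup>t k\<^sub>t\<close>. So all of them lead back to the zero set condition.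

  Finally, a continuous linear map \<open>\<phi>\<close> is the multiplication by its matrix: up to a summand in a small
  neighbourhood of zero, which does not affect the coordinate \<open>h\<close> of the image, every column has
  finite support and is a linear combination of the \<open>\<delta>\<^sup>g\<close> (\<open>matrix_of_mult\<close>).
\<close>

section \<open>Filters and their duals\<close>

lemma filter_on_upward:
  "filter_on S F \<Longrightarrow> A \<in> F \<Longrightarrow> A \<subseteq> B \<Longrightarrow> B \<subseteq> S \<Longrightarrow> B \<in> F"
  unfolding filter_on_def by blast

lemma filter_on_subset: "filter_on S F \<Longrightarrow> A \<in> F \<Longrightarrow> A \<subseteq> S"
  unfolding filter_on_def by (meson PowD subsetD)

lemma balanced_filter_on: "balanced S F \<Longrightarrow> filter_on S F"
  unfolding balanced_def by blast

lemma balanced_perp_perp: "balanced S F \<Longrightarrow> perp S (perp S F) = F"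
  unfolding balanced_def by blast

lemma balanced_perp: "balanced S F \<Longrightarrow> balanced S (perp S F)"
  by (simp add: balanced_def filter_on_perp)

lemma perp_finite: "A \<in> perp S F \<Longrightarrow> B \<in> F \<Longrightarrow> finite (S - (A \<union> B))"
  unfolding perp_def by blast

lemma perp_cofinite:
  assumes "finite E"
  shows "S - E \<in> perp S F"
proof -
  have "finite (S - ((S - E) \<union> B))" for B
    by (rule finite_subset[OF _ assms]) auto
  then show ?thesis by (auto simp: perp_def)
qed

lemma balanced_cofinite:
  assumes "balanced S F" "finite E"
  shows "S - E \<in> F"
  using perp_cofinite[OF assms(2), of S "perp S F"] balanced_perp_perp[OF assms(1)] by simp

lemma involution_on_image_image:
  assumes "involution_on S \<sigma>" "A \<subseteq> S"
  shows "\<sigma> ` \<sigma> ` A = A"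
  using assms unfolding involution_on_def by (force simp: image_image)

lemma involution_on_image_subset:
  assumes "involution_on S \<sigma>" "A \<subseteq> S"
  shows "\<sigma> ` A \<subseteq> S"
  using assms unfolding involution_on_def by blast

lemma star_filter_iff:
  assumes "involution_on S \<sigma>" "F \<subseteq> Pow S"
  shows "A \<in> star_filter \<sigma> F \<longleftrightarrow> A \<subseteq> S \<and> \<sigma> ` A \<in> F"
proof
  assume "A \<in> star_filter \<sigma> F"
  then obtain B where "B \<in> F" "A = \<sigma> ` B" by (auto simp: star_filter_def)
  then show "A \<subseteq> S \<and> \<sigma> ` A \<in> F"
    using assms involution_on_image_image involution_on_image_subset by (metis PowD subsetD)
next
  assume "A \<subseteq> S \<and> \<sigma> ` A \<in> F"
  then have "\<sigma> ` \<sigma> ` A \<in> star_filter \<sigma> F" unfolding star_filter_def by blast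
  then show "A \<in> star_filter \<sigma> F"
    using involution_on_image_image[OF assms(1)] \<open>A \<subseteq> S \<and> \<sigma> ` A \<in> F\<close> by simp
qed

text \<open>
  An involution is a bijection that preserves cofiniteness, so it commutes with the dual. With
  balancedness this turns the double dual of \<open>star_filter \<sigma> (perp G \<GG>)\<close> inside the pair filter into
  \<open>star_filter \<sigma> \<GG>\<close>.
\<close>

lemma perp_star_filter:
  assumes inv: "involution_on S \<sigma>" and F: "F \<subseteq> Pow S"
  shows "perp S (star_filter \<sigma> F) = star_filter \<sigma> (perp S F)"
proof -
  have inj: "inj_on \<sigma> S"
    using inv unfolding involution_on_def by (metis inj_onI)
  have img: "\<sigma> ` S = S"
    using involution_on_image_image[OF inv order_refl] involution_on_image_subset[OF inv] by blast
  have fin: "finite (S - (A \<union> \<sigma> ` B)) \<longleftrightarrow> finite (S - (\<sigma> ` A \<union> B))" if "A \<subseteq> S" "B \<subseteq> S" for A B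
  proof -
    have "\<sigma> ` (S - (A \<union> \<sigma> ` B)) = \<sigma> ` S - (\<sigma> ` A \<union> \<sigma> ` \<sigma> ` B)"
      using inj that involution_on_image_subset[OF inv] by (simp add: inj_on_image_set_diff image_Un)
    also have "\<dots> = S - (\<sigma> ` A \<union> B)"
      using img involution_on_image_image[OF inv that(2)] by simp
    finally have "finite (S - (\<sigma> ` A \<union> B)) \<longleftrightarrow> finite (\<sigma> ` (S - (A \<union> \<sigma> ` B)))" by simp
    also have "\<dots> \<longleftrightarrow> finite (S - (A \<union> \<sigma> ` B))"
      by (rule finite_image_iff) (rule inj_on_subset[OF inj], blast)
    finally show ?thesis by simp
  qed
  have "perp S F \<subseteq> Pow S" by (auto simp: perp_def)
  then have "A \<in> star_filter \<sigma> (perp S F) \<longleftrightarrow> A \<subseteq> S \<and> \<sigma> ` A \<in> perp S F" for A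
    by (rule star_filter_iff[OF inv])
  moreover have "A \<in> perp S (star_filter \<sigma> F) \<longleftrightarrow> A \<subseteq> S \<and> \<sigma> ` A \<in> perp S F" for A
  proof (cases "A \<subseteq> S")
    case True
    then have "A \<in> perp S (star_filter \<sigma> F) \<longleftrightarrow> (\<forall>B\<in>F. finite (S - (A \<union> \<sigma> ` B)))"
      by (simp add: perp_def star_filter_def)
    also have "\<dots> \<longleftrightarrow> (\<forall>B\<in>F. finite (S - (\<sigma> ` A \<union> B)))"
      using fin[OF True] F by (meson PowD subsetD)
    also have "\<dots> \<longleftrightarrow> \<sigma> ` A \<in> perp S F"
      using involution_on_image_subset[OF inv True] by (simp add: perp_def)
    finally show ?thesis using True by simp
  qed (simp add: perp_def)
  ultimately show ?thesis by blast
qed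

section \<open>Vanishing on rectangles\<close>

text \<open>
  Both halves of the zero set condition are instances of this one notion: the roles of \<open>H\<close> and \<open>G\<close>
  are interchanged and both filters are replaced by their duals.
\<close>

definition vanishes_on_rectangles ::
    "'h set set \<Rightarrow> 'g set \<Rightarrow> 'g set set \<Rightarrow> ('h \<Rightarrow> 'g \<Rightarrow> 'k::zero) \<Rightarrow> bool" where
  "vanishes_on_rectangles P G Q M \<longleftrightarrow> (\<forall>A\<in>Q. \<exists>B\<in>P. \<forall>h\<in>B. \<forall>g\<in>G - A. M h g = 0)"

lemma vanishes_on_rectanglesE:
  assumes "vanishes_on_rectangles P G Q M" "A \<in> Q"
  obtains B where "B \<in> P" "\<forall>h\<in>B. \<forall>g\<in>G - A. M h g = 0"
proof -
  from bspec[OF assms(1)[unfolded vanishes_on_rectangles_def] assms(2)]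
  show thesis using that by (rule bexE)
qed

lemma vanishes_on_rectangles_mono:
  assumes "vanishes_on_rectangles P G Q M" "P \<subseteq> Pow H"
    and "\<And>h g. h \<in> H \<Longrightarrow> g \<in> G \<Longrightarrow> M h g = 0 \<Longrightarrow> N h g = 0"
  shows "vanishes_on_rectangles P G Q N"
  unfolding vanishes_on_rectangles_def
proof
  fix A assume "A \<in> Q"
  then obtain B where B: "B \<in> P" "\<forall>h\<in>B. \<forall>g\<in>G - A. M h g = 0"
    by (rule vanishes_on_rectanglesE[OF assms(1)])
  then have "\<forall>h\<in>B. \<forall>g\<in>G - A. N h g = 0"
    using assms(2) by (meson DiffD1 PowD assms(3) subsetD)
  with B(1) show "\<exists>B\<in>P. \<forall>h\<in>B. \<forall>g\<in>G - A. N h g = 0" by (rule bexI[rotated])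
qed

text \<open>
  The heart of the theorem. In a balanced filter membership is tested by cofiniteness against the
  dual filter, and the dual rectangles leave only finitely many columns to be examined.
\<close>

lemma vanishes_on_rectangles_transpose:
  assumes P: "balanced H P"
    and columns: "\<And>g. g \<in> G \<Longrightarrow> zero_set H (\<lambda>h. M h g) \<in> P"
    and vanish: "vanishes_on_rectangles (perp G Q) H (perp H P) (\<lambda>g h. M h g)"
  shows "vanishes_on_rectangles P G Q M"
  unfolding vanishes_on_rectangles_def
proof
  fix A assume A: "A \<in> Q"
  define B where "B = {h\<in>H. \<forall>g\<in>G - A. M h g = 0}"
  have "finite (H - (B \<union> C))" if C: "C \<in> perp H P" for C
  proof -
    obtain A' where A': "A' \<in> perp G Q" and zero: "\<forall>g\<in>A'. \<forall>h\<in>H - C. M h g = 0"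
      by (rule vanishes_on_rectanglesE[OF vanish C])
    have "H - (B \<union> C) \<subseteq> (\<Union>g\<in>G - (A' \<union> A). H - (C \<union> zero_set H (\<lambda>h. M h g)))"
      using zero by (force simp: B_def zero_set_def)
    moreover have "finite (\<Union>g\<in>G - (A' \<union> A). H - (C \<union> zero_set H (\<lambda>h. M h g)))"
      using perp_finite[OF A' A] perp_finite[OF C columns] by blast
    ultimately show ?thesis by (rule finite_subset)
  qed
  then have "B \<in> perp H (perp H P)" by (auto simp: perp_def B_def)
  then have "B \<in> P" using balanced_perp_perp[OF P] by simp
  then show "\<exists>B\<in>P. \<forall>h\<in>B. \<forall>g\<in>G - A. M h g = 0"
    by (rule rev_bexI) (simp add: B_def)
qed

text \<open>
  The complement of a single index belongs to every dual filter, so a single column is a rectangle.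
\<close>

lemma vanishes_on_rectangles_section:
  assumes P: "filter_on H P"
    and vanish: "vanishes_on_rectangles P G (perp G Q) M"
    and sub: "g \<in> G"
  shows "zero_set H (\<lambda>h. M h g) \<in> P"
proof -
  have "G - {g} \<in> perp G Q" by (rule perp_cofinite) simp
  then obtain B where B: "B \<in> P" "\<forall>h\<in>B. \<forall>g'\<in>G - (G - {g}). M h g' = 0"
    by (rule vanishes_on_rectanglesE[OF vanish])
  then show ?thesis
    using sub filter_on_subset[OF P B(1)]
    by (intro filter_on_upward[OF P B(1)]) (auto simp: zero_set_def)
qed

text \<open>
  The involution disappears from the zero set condition once the columns are reindexed by it.
\<close>

lemma zero_set_in_pair_filter_iff:
  fixes \<Phi> :: "'h \<times> 'g \<Rightarrow> 'k::division_ring"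
  assumes inv: "involution_on G \<sigma>" and G: "balanced G \<GG>" and H: "balanced H \<HH>"
  shows "zero_set_in_pair_filter G \<sigma> \<GG> H \<HH> \<Phi> \<longleftrightarrow>
    vanishes_on_rectangles \<HH> G \<GG> (\<lambda>h g. \<Phi> (h, \<sigma> g)) \<and>
    vanishes_on_rectangles (perp G \<GG>) H (perp H \<HH>) (\<lambda>g h. \<Phi> (h, \<sigma> g))"
proof -
  have perpsub: "perp G \<GG> \<subseteq> Pow G" by (auto simp: perp_def)
  have dual: "perp G (star_filter \<sigma> (perp G \<GG>)) = star_filter \<sigma> \<GG>"
    using perp_star_filter[OF inv perpsub] balanced_perp_perp[OF G] by simp
  have \<sigma>: "\<sigma> g \<in> G" "\<sigma> (\<sigma> g) = g" if "g \<in> G" for g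
    using inv that unfolding involution_on_def by auto
  have 1: "B \<times> (G - \<sigma> ` A) \<subseteq> zero_set (H \<times> G) \<Phi> \<longleftrightarrow> (\<forall>h\<in>B. \<forall>g\<in>G - A. \<Phi> (h, \<sigma> g) = 0)"
    if A: "A \<subseteq> G" and B: "B \<subseteq> H" for A B
  proof
    assume L: "B \<times> (G - \<sigma> ` A) \<subseteq> zero_set (H \<times> G) \<Phi>"
    have "\<sigma> g \<in> G - \<sigma> ` A" if "g \<in> G - A" for g
      using that \<sigma> A by (metis DiffD1 DiffD2 DiffI imageE subsetD)
    with L show "\<forall>h\<in>B. \<forall>g\<in>G - A. \<Phi> (h, \<sigma> g) = 0" unfolding zero_set_def by blast
  next
    assume R: "\<forall>h\<in>B. \<forall>g\<in>G - A. \<Phi> (h, \<sigma> g) = 0"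
    have "\<Phi> (h, g) = 0" if "h \<in> B" "g \<in> G - \<sigma> ` A" for h g
    proof -
      have "\<sigma> g \<in> G - A" using that \<sigma> by (metis DiffD1 DiffD2 DiffI imageI)
      then show ?thesis using R that \<sigma>(2) by (metis DiffD1)
    qed
    with B show "B \<times> (G - \<sigma> ` A) \<subseteq> zero_set (H \<times> G) \<Phi>" unfolding zero_set_def by auto
  qed
  have 2: "(H - B) \<times> \<sigma> ` A \<subseteq> zero_set (H \<times> G) \<Phi> \<longleftrightarrow> (\<forall>g\<in>A. \<forall>h\<in>H - B. \<Phi> (h, \<sigma> g) = 0)"
    if A: "A \<subseteq> G" for A B
  proof -
    have "(H - B) \<times> \<sigma> ` A \<subseteq> H \<times> G"
      using involution_on_image_subset[OF inv A] by blast
    then have "(H - B) \<times> \<sigma> ` A \<subseteq> zero_set (H \<times> G) \<Phi> \<longleftrightarrow>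
        (\<forall>x\<in>(H - B) \<times> \<sigma> ` A. \<Phi> x = 0)"
      unfolding zero_set_def by blast
    then show ?thesis by auto
  qed
  have "zero_set (H \<times> G) \<Phi> \<subseteq> H \<times> G" by (auto simp: zero_set_def)
  then have "zero_set_in_pair_filter G \<sigma> \<GG> H \<HH> \<Phi> \<longleftrightarrow>
     (\<forall>A\<in>\<GG>. \<exists>B\<in>\<HH>. B \<times> (G - \<sigma> ` A) \<subseteq> zero_set (H \<times> G) \<Phi>) \<and>
     (\<forall>B\<in>perp H \<HH>. \<exists>A\<in>perp G \<GG>. (H - B) \<times> \<sigma> ` A \<subseteq> zero_set (H \<times> G) \<Phi>)"
    unfolding zero_set_in_pair_filter_def pair_filter_def dual by (simp add: star_filter_def)
  moreover have "(\<exists>B\<in>\<HH>. B \<times> (G - \<sigma> ` A) \<subseteq> zero_set (H \<times> G) \<Phi>) \<longleftrightarrow>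
      (\<exists>B\<in>\<HH>. \<forall>h\<in>B. \<forall>g\<in>G - A. \<Phi> (h, \<sigma> g) = 0)" if "A \<in> \<GG>" for A
    by (rule bex_cong[OF refl 1])
      (use that filter_on_subset[OF balanced_filter_on[OF G]]
        filter_on_subset[OF balanced_filter_on[OF H]] in auto)
  moreover have "(\<exists>A\<in>perp G \<GG>. (H - B) \<times> \<sigma> ` A \<subseteq> zero_set (H \<times> G) \<Phi>) \<longleftrightarrow>
      (\<exists>A\<in>perp G \<GG>. \<forall>g\<in>A. \<forall>h\<in>H - B. \<Phi> (h, \<sigma> g) = 0)" for B
    by (rule bex_cong[OF refl 2]) (simp add: perp_def)
  ultimately show ?thesis unfolding vanishes_on_rectangles_def by simp
qed

section \<open>Continuous linear maps\<close>

lemma Funct_zero: "filter_on S F \<Longrightarrow> (\<lambda>s. 0) \<in> Funct S F"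
  unfolding filter_on_def Funct_def functions_on_def zero_set_def by auto

lemma FunctI:
  assumes F: "filter_on S F" and "a \<in> functions_on S" "A \<in> F" "\<And>s. s \<in> A \<Longrightarrow> a s = 0"
  shows "a \<in> Funct S F"
  using filter_on_upward[OF F \<open>A \<in> F\<close>, of "zero_set S a"] filter_on_subset[OF F \<open>A \<in> F\<close>] assms(2,4)
  by (auto simp: Funct_def zero_set_def)

lemma Funct_finite_support:
  assumes F: "balanced S F" and fin: "finite E" "E \<subseteq> S" and "\<And>s. s \<notin> E \<Longrightarrow> a s = 0"
  shows "a \<in> Funct S F"
  by (rule FunctI[OF balanced_filter_on[OF F] _ balanced_cofinite[OF F fin(1)]])
    (use assms in \<open>auto simp: functions_on_def\<close>)

lemma delta_in_Funct:
  assumes "balanced S F" "s \<in> S"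
  shows "(\<lambda>x. delta s x * k) \<in> Funct S F"
  by (rule Funct_finite_support[OF assms(1), of "{s}"]) (use assms in \<open>auto simp: delta_def\<close>)

lemma delta_in_basic_nhd:
  assumes "balanced S F" "s \<in> A" "A \<subseteq> S"
  shows "delta s \<in> basic_nhd S F A"
  using delta_in_Funct[OF assms(1), of s 1] assms(2,3)
  by (auto simp: basic_nhd_def supp_def delta_def)

lemma right_linear_Funct:
  "right_linear G \<GG> H \<HH> \<phi> \<Longrightarrow> a \<in> Funct G \<GG> \<Longrightarrow> \<phi> a \<in> Funct H \<HH>"
  by (auto simp: right_linear_def)

lemma right_linear_add:
  "right_linear G \<GG> H \<HH> \<phi> \<Longrightarrow> a \<in> Funct G \<GG> \<Longrightarrow> b \<in> Funct G \<GG> \<Longrightarrow>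
    \<phi> (\<lambda>g. a g + b g) = (\<lambda>h. \<phi> a h + \<phi> b h)"
  by (simp add: right_linear_def)

lemma right_linear_scale:
  "right_linear G \<GG> H \<HH> \<phi> \<Longrightarrow> a \<in> Funct G \<GG> \<Longrightarrow> \<phi> (\<lambda>g. a g * k) = (\<lambda>h. \<phi> a h * k)"
  by (simp add: right_linear_def)

lemma right_linear_zero:
  assumes "filter_on G \<GG>" "right_linear G \<GG> H \<HH> \<phi>"
  shows "\<phi> (\<lambda>g. 0) = (\<lambda>h. 0)"
  using right_linear_scale[OF assms(2) Funct_zero[OF assms(1)], of 0] by simp

text \<open>
  As for all linear topologies, continuity of a linear map need only be tested at zero.
\<close>

lemma continuous_right_linear_iff:
  fixes \<phi> :: "('g \<Rightarrow> 'k::division_ring) \<Rightarrow> 'h \<Rightarrow> 'k"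
  assumes G: "filter_on G \<GG>" and H: "filter_on H \<HH>" and lin: "right_linear G \<GG> H \<HH> \<phi>"
  shows "continuous_map (filter_topology G \<GG>) (filter_topology H \<HH>) \<phi> \<longleftrightarrow>
    (\<forall>B\<in>perp H \<HH>. \<exists>A\<in>perp G \<GG>. \<phi> ` basic_nhd G \<GG> A \<subseteq> basic_nhd H \<HH> B)"
proof
  assume cont: "continuous_map (filter_topology G \<GG>) (filter_topology H \<HH>) \<phi>"
  show "\<forall>B\<in>perp H \<HH>. \<exists>A\<in>perp G \<GG>. \<phi> ` basic_nhd G \<GG> A \<subseteq> basic_nhd H \<HH> B"
  proof
    fix B assume "B \<in> perp H \<HH>"
    then have "openin (filter_topology G \<GG>)
        {x \<in> topspace (filter_topology G \<GG>). \<phi> x \<in> basic_nhd H \<HH> B}"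
      using cont openin_basic_nhd[OF H] by (rule_tac openin_continuous_map_preimage)
    then have op: "openin (filter_topology G \<GG>) {x \<in> Funct G \<GG>. \<phi> x \<in> basic_nhd H \<HH> B}"
      by (simp add: topspace_filter_topology[OF G])
    have "(\<lambda>g. 0) \<in> {x \<in> Funct G \<GG>. \<phi> x \<in> basic_nhd H \<HH> B}"
      using Funct_zero[OF G] Funct_zero[OF H] right_linear_zero[OF G lin]
      by (auto simp: basic_nhd_def supp_def)
    from bspec[OF conjunct2[OF op[unfolded openin_filter_topology]] this]
    obtain A where "A \<in> perp G \<GG>"
        "(\<lambda>u s. 0 + u s) ` basic_nhd G \<GG> A \<subseteq> {x \<in> Funct G \<GG>. \<phi> x \<in> basic_nhd H \<HH> B}"
      by (rule bexE)
    then show "\<exists>A\<in>perp G \<GG>. \<phi> ` basic_nhd G \<GG> A \<subseteq> basic_nhd H \<HH> B"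
      by (auto simp: image_subset_iff intro!: bexI[of _ A])
  qed
next
  assume nhd: "\<forall>B\<in>perp H \<HH>. \<exists>A\<in>perp G \<GG>. \<phi> ` basic_nhd G \<GG> A \<subseteq> basic_nhd H \<HH> B"
  show "continuous_map (filter_topology G \<GG>) (filter_topology H \<HH>) \<phi>"
    unfolding continuous_map topspace_filter_topology[OF G] topspace_filter_topology[OF H]
  proof (intro conjI allI impI)
    show "\<phi> ` Funct G \<GG> \<subseteq> Funct H \<HH>" using right_linear_Funct[OF lin] by blast
  next
    fix V :: "('h \<Rightarrow> 'k) set" assume V: "openin (filter_topology H \<HH>) V"
    show "openin (filter_topology G \<GG>) {x \<in> Funct G \<GG>. \<phi> x \<in> V}"
      unfolding openin_filter_topology
    proof (intro conjI ballI)
      fix f assume f: "f \<in> {x \<in> Funct G \<GG>. \<phi> x \<in> V}"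
      then have "\<phi> f \<in> V" by simp
      from bspec[OF conjunct2[OF V[unfolded openin_filter_topology]] this]
      obtain B where B: "B \<in> perp H \<HH>" "(\<lambda>u s. \<phi> f s + u s) ` basic_nhd H \<HH> B \<subseteq> V"
        by (rule bexE)
      obtain A where A: "A \<in> perp G \<GG>" "\<phi> ` basic_nhd G \<GG> A \<subseteq> basic_nhd H \<HH> B"
        using nhd B(1) by blast
      have "(\<lambda>s. f s + u s) \<in> {x \<in> Funct G \<GG>. \<phi> x \<in> V}" if u: "u \<in> basic_nhd G \<GG> A" for u
      proof -
        have uF: "u \<in> Funct G \<GG>" using u by (simp add: basic_nhd_def)
        have "\<phi> (\<lambda>s. f s + u s) = (\<lambda>s. \<phi> f s + \<phi> u s)"
          using f by (intro right_linear_add[OF lin _ uF]) simp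
        moreover have "(\<lambda>s. \<phi> f s + \<phi> u s) \<in> V" using A(2) B(2) u by blast
        ultimately show ?thesis using Funct_add[OF G _ uF, of f] f by simp
      qed
      then show "\<exists>A\<in>perp G \<GG>. (\<lambda>u s. f s + u s) ` basic_nhd G \<GG> A \<subseteq> {x \<in> Funct G \<GG>. \<phi> x \<in> V}"
        using A(1) by blast
    qed blast
  qed
qed

text \<open>
  Only the values at the \<open>\<delta>\<^sup>g\<close> enter: for \<open>g\<close> in a set \<open>A\<close> of the dual filter, \<open>\<delta>\<^sup>g\<close> lies in the basic
  neighbourhood of \<open>A\<close>, so continuity makes the columns with index in \<open>A\<close> vanish together outside \<open>B\<close>.
  The other half follows by transposition. The entries of \<open>\<Phi>\<close> are given by a hypothesis because the
  lemma is needed both for a given matrix that multiplies continuously and for the matrix of a map.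
\<close>

lemma continuous_right_linear_zero_set:
  fixes \<phi> :: "('g \<Rightarrow> 'k::division_ring) \<Rightarrow> 'h \<Rightarrow> 'k"
  assumes inv: "involution_on G \<sigma>" and G: "balanced G \<GG>" and H: "balanced H \<HH>"
    and lin: "right_linear G \<GG> H \<HH> \<phi>"
    and cont: "continuous_map (filter_topology G \<GG>) (filter_topology H \<HH>) \<phi>"
    and entry: "\<And>h g. h \<in> H \<Longrightarrow> g \<in> G \<Longrightarrow> \<Phi> (h, \<sigma> g) = \<phi> (delta g) h"
  shows "zero_set_in_pair_filter G \<sigma> \<GG> H \<HH> \<Phi>"
proof -
  have vanish: "vanishes_on_rectangles (perp G \<GG>) H (perp H \<HH>) (\<lambda>g h. \<phi> (delta g) h)"
    unfolding vanishes_on_rectangles_def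
  proof
    fix B assume "B \<in> perp H \<HH>"
    then obtain A where A: "A \<in> perp G \<GG>" "\<phi> ` basic_nhd G \<GG> A \<subseteq> basic_nhd H \<HH> B"
      using cont continuous_right_linear_iff[OF balanced_filter_on[OF G] balanced_filter_on[OF H] lin]
      by blast
    have "\<phi> (delta g) \<in> basic_nhd H \<HH> B" if "g \<in> A" for g
      using A delta_in_basic_nhd[OF G that] unfolding perp_def by blast
    then have "\<forall>g\<in>A. \<forall>h\<in>H - B. \<phi> (delta g) h = 0"
      by (auto simp: basic_nhd_def supp_def)
    with A(1) show "\<exists>A\<in>perp G \<GG>. \<forall>g\<in>A. \<forall>h\<in>H - B. \<phi> (delta g) h = 0" by blast
  qed
  have "zero_set H (\<lambda>h. \<phi> (delta g) h) \<in> \<HH>" if "g \<in> G" for g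
  proof -
    have "\<phi> (delta g) \<in> Funct H \<HH>"
      using right_linear_Funct[OF lin] delta_in_Funct[OF G that, of 1] by simp
    then show ?thesis by (simp add: Funct_def)
  qed
  then have transposed: "vanishes_on_rectangles \<HH> G \<GG> (\<lambda>h g. \<phi> (delta g) h)"
    by (rule vanishes_on_rectangles_transpose[OF H _ vanish])
  have sub: "\<HH> \<subseteq> Pow H" "perp G \<GG> \<subseteq> Pow G"
    using filter_on_subset[OF balanced_filter_on[OF H]] by (auto simp: perp_def)
  show ?thesis
    unfolding zero_set_in_pair_filter_iff[OF inv G H]
    by (intro conjI vanishes_on_rectangles_mono[OF transposed sub(1)]
        vanishes_on_rectangles_mono[OF vanish sub(2)]) (simp_all add: entry)
qed

lemma right_linear_finite_support:
  fixes \<phi> :: "('g \<Rightarrow> 'k::division_ring) \<Rightarrow> 'h \<Rightarrow> 'k"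
  assumes G: "balanced G \<GG>" and lin: "right_linear G \<GG> H \<HH> \<phi>" and "finite E" "E \<subseteq> G"
  shows "\<phi> (\<lambda>g. if g \<in> E then a g else 0) = (\<lambda>h. \<Sum>g\<in>E. \<phi> (delta g) h * a g)"
  using assms(3,4)
proof (induction E rule: finite_induct)
  case empty
  then show ?case using right_linear_zero[OF balanced_filter_on[OF G] lin] by simp
next
  case (insert x E)
  let ?b = "\<lambda>g. if g \<in> E then a g else 0"
  have x: "delta x \<in> Funct G \<GG>" "(\<lambda>g. delta x g * a x) \<in> Funct G \<GG>"
    using delta_in_Funct[OF G, of x 1] delta_in_Funct[OF G, of x "a x"] insert.prems by auto
  have b: "?b \<in> Funct G \<GG>"
    by (rule Funct_finite_support[OF G insert.hyps(1)]) (use insert.prems in auto)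
  have "(\<lambda>g. if g \<in> insert x E then a g else 0) = (\<lambda>g. delta x g * a x + ?b g)"
    using insert.hyps(2) by (auto simp: delta_def)
  then have "\<phi> (\<lambda>g. if g \<in> insert x E then a g else 0) = \<phi> (\<lambda>g. delta x g * a x + ?b g)" by simp
  also have "\<dots> = (\<lambda>h. \<phi> (\<lambda>g. delta x g * a x) h + \<phi> ?b h)"
    by (rule right_linear_add[OF lin x(2) b])
  also have "\<phi> (\<lambda>g. delta x g * a x) = (\<lambda>h. \<phi> (delta x) h * a x)"
    by (rule right_linear_scale[OF lin x(1)])
  also have "\<phi> ?b = (\<lambda>h. \<Sum>g\<in>E. \<phi> (delta g) h * a g)" using insert by simp
  finally show ?case using insert.hyps by simp
qed

section \<open>Multiplication by a matrix\<close>

text \<open>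
  The sum in \<open>mat_mult\<close> runs over the exact support of the summand, which changes with the column; a
  larger finite index set common to several columns makes the products comparable.
\<close>

lemma mat_mult_eq_sum:
  assumes "finite E" "E \<subseteq> G" "\<And>g. g \<in> G - E \<Longrightarrow> \<Phi> (h, \<sigma> g) * a g = 0"
  shows "mat_mult G \<sigma> \<Phi> a h = (\<Sum>g\<in>E. \<Phi> (h, \<sigma> g) * a g)"
  unfolding mat_mult_def
  by (rule sum.mono_neutral_left) (use assms in auto)

lemma mat_mult_delta:
  assumes "g \<in> G"
  shows "mat_mult G \<sigma> \<Phi> (\<lambda>x. delta g x * k) = (\<lambda>h. \<Phi> (h, \<sigma> g) * k)"
proof
  fix h
  show "mat_mult G \<sigma> \<Phi> (\<lambda>x. delta g x * k) h = \<Phi> (h, \<sigma> g) * k"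
    by (subst mat_mult_eq_sum[where E = "{g}"]) (use assms in \<open>auto simp: delta_def\<close>)
qed

lemma mat_mult_eq_0:
  assumes "\<And>g. g \<in> G \<Longrightarrow> \<Phi> (h, \<sigma> g) * a g = 0"
  shows "mat_mult G \<sigma> \<Phi> a h = 0"
  by (subst mat_mult_eq_sum[where E = "{}"]) (use assms in auto)

lemma mat_mult_functions_on:
  assumes "\<Phi> \<in> functions_on (H \<times> G)"
  shows "mat_mult G \<sigma> \<Phi> a \<in> functions_on H"
  unfolding functions_on_def
  by (auto intro!: mat_mult_eq_0) (use assms in \<open>auto simp: functions_on_def\<close>)

lemma mult_defines_map_right_linear:
  fixes \<Phi> :: "'h \<times> 'g \<Rightarrow> 'k::division_ring"
  assumes G: "filter_on G \<GG>" and \<Phi>: "\<Phi> \<in> functions_on (H \<times> G)"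
    and map: "mult_defines_map G \<sigma> \<GG> H \<HH> \<Phi>"
  shows "right_linear G \<GG> H \<HH> (mat_mult G \<sigma> \<Phi>)"
  unfolding right_linear_def
proof (intro conjI ballI allI)
  show "mat_mult G \<sigma> \<Phi> \<in> Funct G \<GG> \<rightarrow> Funct H \<HH>"
    using map unfolding mult_defines_map_def by blast
next
  fix a b :: "'g \<Rightarrow> 'k" assume ab: "a \<in> Funct G \<GG>" "b \<in> Funct G \<GG>"
  show "mat_mult G \<sigma> \<Phi> (\<lambda>g. a g + b g) = (\<lambda>h. mat_mult G \<sigma> \<Phi> a h + mat_mult G \<sigma> \<Phi> b h)"
  proof
    fix h
    show "mat_mult G \<sigma> \<Phi> (\<lambda>g. a g + b g) h = mat_mult G \<sigma> \<Phi> a h + mat_mult G \<sigma> \<Phi> b h"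
    proof (cases "h \<in> H")
      case True
      let ?E = "{g\<in>G. \<Phi> (h, \<sigma> g) * a g \<noteq> 0} \<union> {g\<in>G. \<Phi> (h, \<sigma> g) * b g \<noteq> 0}"
      have E: "finite ?E" "?E \<subseteq> G"
        using map ab True unfolding mult_defines_map_def mult_defined_def by auto
      have "mat_mult G \<sigma> \<Phi> c h = (\<Sum>g\<in>?E. \<Phi> (h, \<sigma> g) * c g)"
        if "c \<in> {a, b, \<lambda>g. a g + b g}" for c
        by (rule mat_mult_eq_sum[OF E]) (use that in \<open>auto simp: distrib_left\<close>)
      then show ?thesis by (simp add: distrib_left sum.distrib)
    next
      case False
      then show ?thesis using mat_mult_functions_on[OF \<Phi>, of \<sigma>] by (simp add: functions_on_def)
    qed
  qed
next
  fix a :: "'g \<Rightarrow> 'k" and k assume a: "a \<in> Funct G \<GG>"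
  show "mat_mult G \<sigma> \<Phi> (\<lambda>g. a g * k) = (\<lambda>h. mat_mult G \<sigma> \<Phi> a h * k)"
  proof
    fix h
    show "mat_mult G \<sigma> \<Phi> (\<lambda>g. a g * k) h = mat_mult G \<sigma> \<Phi> a h * k"
    proof (cases "h \<in> H")
      case True
      let ?E = "{g\<in>G. \<Phi> (h, \<sigma> g) * a g \<noteq> 0}"
      have E: "finite ?E" "?E \<subseteq> G"
        using map a True unfolding mult_defines_map_def mult_defined_def by auto
      have "mat_mult G \<sigma> \<Phi> (\<lambda>g. a g * k) h = (\<Sum>g\<in>?E. \<Phi> (h, \<sigma> g) * (a g * k))"
        by (rule mat_mult_eq_sum[OF E]) auto
      then show ?thesis by (simp add: mat_mult_def sum_distrib_right mult.assoc)
    next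
      case False
      then show ?thesis using mat_mult_functions_on[OF \<Phi>, of \<sigma>] by (simp add: functions_on_def)
    qed
  qed
qed

lemma has_tych_sum_vanishes:
  assumes "has_tych_sum S J v f" "s \<in> S" "\<And>j. j \<in> J \<Longrightarrow> v j s = 0"
  shows "f s = 0"
proof -
  have "f s = (\<Sum>j\<in>{j\<in>J. v j s \<noteq> 0}. v j s)"
    using assms(1,2) by (simp add: has_tych_sum_def)
  then show ?thesis using assms(3) by (simp add: sum.neutral)
qed

lemma has_tych_sum_delta:
  fixes k :: "'s \<Rightarrow> 'k::division_ring"
  assumes "J \<subseteq> S"
  shows "has_tych_sum S J (\<lambda>t s. delta t s * k t) (\<lambda>s. if s \<in> J then k s else 0)"
proof -
  have "finite {t\<in>J. delta t s * k t \<noteq> 0} \<and>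
      (if s \<in> J then k s else 0) = (\<Sum>t\<in>{t\<in>J. delta t s * k t \<noteq> 0}. delta t s * k t)" for s
  proof (cases "s \<in> J \<and> k s \<noteq> 0")
    case True
    then have single: "{t\<in>J. delta t s * k t \<noteq> 0} = {s}" by (auto simp: delta_def)
    show ?thesis unfolding single using True by (simp add: delta_def)
  next
    case False
    then have empty: "{t\<in>J. delta t s * k t \<noteq> 0} = {}" by (auto simp: delta_def)
    show ?thesis unfolding empty using False by auto
  qed
  moreover have "(\<lambda>s. delta t s * k t) \<in> functions_on S" if "t \<in> J" for t
    using assms that by (auto simp: functions_on_def delta_def)
  moreover have "(\<lambda>s. if s \<in> J then k s else 0) \<in> functions_on S"
    using assms by (auto simp: functions_on_def)
  ultimately show ?thesis unfolding has_tych_sum_def by (intro conjI ballI) auto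
qed

lemma filter_linear_sum:
  fixes v :: "'j \<Rightarrow> 'g \<Rightarrow> 'k::division_ring"
  assumes "filter_linear TYPE('j) G \<GG> H \<HH> \<phi>" "\<And>j. j \<in> J \<Longrightarrow> v j \<in> Funct G \<GG>"
    and "has_filter_sum G \<GG> J v f"
  shows "has_filter_sum H \<HH> J (\<lambda>j. \<phi> (v j)) (\<phi> f)"
  using assms by (simp add: filter_linear_def)

section \<open>The zero set condition and its consequences\<close>

context
  fixes G :: "'g set" and H :: "'h set" and \<sigma> :: "'g \<Rightarrow> 'g"
    and \<GG> :: "'g set set" and \<HH> :: "'h set set"
    and \<Phi> :: "'h \<times> 'g \<Rightarrow> 'k::division_ring"
  assumes inv: "involution_on G \<sigma>"
    and G: "balanced G \<GG>" and H: "balanced H \<HH>"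
    and \<Phi>: "\<Phi> \<in> functions_on (H \<times> G)"
begin

lemma continuous_imp_zero_set:
  assumes "mult_continuous_linear G \<sigma> \<GG> H \<HH> \<Phi>"
  shows "zero_set_in_pair_filter G \<sigma> \<GG> H \<HH> \<Phi>"
proof -
  have lin: "right_linear G \<GG> H \<HH> (mat_mult G \<sigma> \<Phi>)"
    and cont: "continuous_map (filter_topology G \<GG>) (filter_topology H \<HH>) (mat_mult G \<sigma> \<Phi>)"
    using assms unfolding mult_continuous_linear_def by auto
  show ?thesis
    by (rule continuous_right_linear_zero_set[OF inv G H lin cont])
      (use mat_mult_delta[of _ G \<sigma> \<Phi> 1] in simp)
qed

context
  assumes zero: "zero_set_in_pair_filter G \<sigma> \<GG> H \<HH> \<Phi>"
begin

lemma columns_vanish: "vanishes_on_rectangles \<HH> G \<GG> (\<lambda>h g. \<Phi> (h, \<sigma> g))"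
  and rows_vanish: "vanishes_on_rectangles (perp G \<GG>) H (perp H \<HH>) (\<lambda>g h. \<Phi> (h, \<sigma> g))"
  using zero unfolding zero_set_in_pair_filter_iff[OF inv G H] by (rule conjunct1, rule conjunct2)

text \<open>
  Each row lies in the dual filter, so its support is almost contained in each \<open>A \<in> \<GG>\<close>. This is what
  makes the products with columns of \<open>Funct G \<GG>\<close> finite sums.
\<close>

lemma row_finite:
  assumes "A \<in> \<GG>" "h \<in> H"
  shows "finite {g\<in>G - A. \<Phi> (h, \<sigma> g) \<noteq> 0}"
proof -
  have "zero_set G (\<lambda>g. \<Phi> (h, \<sigma> g)) \<in> perp G \<GG>"
    by (rule vanishes_on_rectangles_section[OF filter_on_perp rows_vanish \<open>h \<in> H\<close>])
  then have "finite (G - (zero_set G (\<lambda>g. \<Phi> (h, \<sigma> g)) \<union> A))"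
    using assms(1) by (rule perp_finite)
  then show ?thesis by (rule rev_finite_subset) (auto simp: zero_set_def)
qed

lemma zero_set_imp_defines_map: "mult_defines_map G \<sigma> \<GG> H \<HH> \<Phi>"
  unfolding mult_defines_map_def
proof (intro ballI conjI)
  fix a :: "'g \<Rightarrow> 'k" assume "a \<in> Funct G \<GG>"
  then have A: "zero_set G a \<in> \<GG>" by (simp add: Funct_def)
  show "mult_defined H G \<sigma> \<Phi> a"
    unfolding mult_defined_def
  proof
    fix h assume "h \<in> H"
    show "finite {g\<in>G. \<Phi> (h, \<sigma> g) * a g \<noteq> 0}"
      by (rule finite_subset[OF _ row_finite[OF A \<open>h \<in> H\<close>]]) (auto simp: zero_set_def)
  qed
  obtain B where B: "B \<in> \<HH>" "\<forall>h\<in>B. \<forall>g\<in>G - zero_set G a. \<Phi> (h, \<sigma> g) = 0"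
    by (rule vanishes_on_rectanglesE[OF columns_vanish A])
  show "mat_mult G \<sigma> \<Phi> a \<in> Funct H \<HH>"
    by (rule FunctI[OF balanced_filter_on[OF H] mat_mult_functions_on[OF \<Phi>] B(1)])
      (use B(2) in \<open>auto intro!: mat_mult_eq_0 simp: zero_set_def\<close>)
qed

lemma zero_set_imp_right_linear: "right_linear G \<GG> H \<HH> (mat_mult G \<sigma> \<Phi>)"
  by (rule mult_defines_map_right_linear[OF balanced_filter_on[OF G] \<Phi> zero_set_imp_defines_map])

lemma zero_set_imp_continuous: "mult_continuous_linear G \<sigma> \<GG> H \<HH> \<Phi>"
proof -
  have "\<exists>A\<in>perp G \<GG>. mat_mult G \<sigma> \<Phi> ` basic_nhd G \<GG> A \<subseteq> basic_nhd H \<HH> B"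
    if B: "B \<in> perp H \<HH>" for B
  proof -
    obtain A where A: "A \<in> perp G \<GG>" "\<forall>g\<in>A. \<forall>h\<in>H - B. \<Phi> (h, \<sigma> g) = 0"
      by (rule vanishes_on_rectanglesE[OF rows_vanish B])
    have "mat_mult G \<sigma> \<Phi> a \<in> basic_nhd H \<HH> B" if a: "a \<in> basic_nhd G \<GG> A" for a
    proof -
      have "mat_mult G \<sigma> \<Phi> a h = 0" if "h \<in> H - B" for h
        by (rule mat_mult_eq_0) (use A(2) a that in \<open>auto simp: basic_nhd_def supp_def\<close>)
      moreover have "mat_mult G \<sigma> \<Phi> a \<in> Funct H \<HH>"
        using zero_set_imp_defines_map a by (simp add: mult_defines_map_def basic_nhd_def)
      ultimately show ?thesis by (auto simp: basic_nhd_def supp_def)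
    qed
    then have "mat_mult G \<sigma> \<Phi> ` basic_nhd G \<GG> A \<subseteq> basic_nhd H \<HH> B" by blast
    with A(1) show ?thesis by (rule bexI[rotated])
  qed
  then show ?thesis
    unfolding mult_continuous_linear_def
      continuous_right_linear_iff[OF balanced_filter_on[OF G] balanced_filter_on[OF H]
        zero_set_imp_right_linear]
    using zero_set_imp_defines_map zero_set_imp_right_linear by simp
qed

text \<open>
  All members of a summable family and their sum vanish on one \<open>A \<in> \<GG>\<close>. A fixed coordinate \<open>h\<close> of the
  images therefore only involves the finitely many \<open>g\<close> of \<open>row_finite\<close>, at which only finitely
  many members of the family are nonzero: the exchange of sums is one of finite sums.
\<close>

lemma zero_set_imp_filter_linear: "mult_filter_linear TYPE('j) G \<sigma> \<GG> H \<HH> \<Phi>"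
  unfolding mult_filter_linear_def filter_linear_def
proof (intro conjI allI impI zero_set_imp_defines_map zero_set_imp_right_linear)
  fix J :: "'j set" and v :: "'j \<Rightarrow> 'g \<Rightarrow> 'k" and f :: "'g \<Rightarrow> 'k"
  let ?A = "{s\<in>G. \<forall>j\<in>J. s \<in> zero_set G (v j)}"
  assume "(\<forall>j\<in>J. v j \<in> Funct G \<GG>) \<and> has_filter_sum G \<GG> J v f"
  then have sum: "has_tych_sum G J v f" and A: "?A \<in> \<GG>"
    by (auto simp: has_filter_sum_def)
  have v0: "v j g = 0" if "g \<in> ?A" "j \<in> J" for j g using that by (auto simp: zero_set_def)
  have f0: "f g = 0" if "g \<in> ?A" for g
    by (rule has_tych_sum_vanishes[OF sum]) (use that v0 in auto)
  have row: "finite {j\<in>J. mat_mult G \<sigma> \<Phi> (v j) h \<noteq> 0} \<and>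
      mat_mult G \<sigma> \<Phi> f h = (\<Sum>j\<in>{j\<in>J. mat_mult G \<sigma> \<Phi> (v j) h \<noteq> 0}. mat_mult G \<sigma> \<Phi> (v j) h)"
    if h: "h \<in> H" for h
  proof -
    define E where "E = {g\<in>G - ?A. \<Phi> (h, \<sigma> g) \<noteq> 0}"
    define J' where "J' = (\<Union>g\<in>E. {j\<in>J. v j g \<noteq> 0})"
    have E: "finite E" "E \<subseteq> G" unfolding E_def using row_finite[OF A h] by auto
    have J': "finite J'" "J' \<subseteq> J"
      using sum E unfolding J'_def has_tych_sum_def by auto
    have \<Phi>v: "mat_mult G \<sigma> \<Phi> (v j) h = (\<Sum>g\<in>E. \<Phi> (h, \<sigma> g) * v j g)" if "j \<in> J" for j
      by (rule mat_mult_eq_sum[OF E]) (use v0 that in \<open>auto simp: E_def\<close>)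
    have zero': "mat_mult G \<sigma> \<Phi> (v j) h = 0" if "j \<in> J - J'" for j
      using that \<Phi>v[of j] by (auto simp: J'_def intro!: sum.neutral)
    have fg: "f g = (\<Sum>j\<in>J'. v j g)" if "g \<in> E" for g
    proof -
      have "f g = (\<Sum>j\<in>{j\<in>J. v j g \<noteq> 0}. v j g)"
        using sum E(2) that by (simp add: has_tych_sum_def subset_iff)
      also have "\<dots> = (\<Sum>j\<in>J'. v j g)"
        by (rule sum.mono_neutral_left[OF J'(1)]) (use that in \<open>auto simp: J'_def\<close>)
      finally show ?thesis .
    qed
    have "mat_mult G \<sigma> \<Phi> f h = (\<Sum>g\<in>E. \<Phi> (h, \<sigma> g) * f g)"
      by (rule mat_mult_eq_sum[OF E]) (use f0 in \<open>auto simp: E_def\<close>)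
    also have "\<dots> = (\<Sum>g\<in>E. \<Sum>j\<in>J'. \<Phi> (h, \<sigma> g) * v j g)"
      using fg by (simp add: sum_distrib_left)
    also have "\<dots> = (\<Sum>j\<in>J'. \<Sum>g\<in>E. \<Phi> (h, \<sigma> g) * v j g)" by (rule sum.swap)
    also have "\<dots> = (\<Sum>j\<in>J'. mat_mult G \<sigma> \<Phi> (v j) h)"
      by (rule sum.cong) (use \<Phi>v J'(2) in auto)
    also have "\<dots> = (\<Sum>j\<in>{j\<in>J. mat_mult G \<sigma> \<Phi> (v j) h \<noteq> 0}. mat_mult G \<sigma> \<Phi> (v j) h)"
      by (rule sum.mono_neutral_right[OF J'(1)]) (use zero' J'(2) in auto)
    finally show ?thesis
      using zero' finite_subset[OF _ J'(1), of "{j\<in>J. mat_mult G \<sigma> \<Phi> (v j) h \<noteq> 0}"] by blast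
  qed
  obtain B where B: "B \<in> \<HH>" "\<forall>h\<in>B. \<forall>g\<in>G - ?A. \<Phi> (h, \<sigma> g) = 0"
    by (rule vanishes_on_rectanglesE[OF columns_vanish A])
  have BH: "B \<subseteq> H" by (rule filter_on_subset[OF balanced_filter_on[OF H] B(1)])
  have "mat_mult G \<sigma> \<Phi> (v j) h = 0" if "h \<in> B" "j \<in> J" for h j
  proof (rule mat_mult_eq_0)
    fix g assume "g \<in> G"
    then show "\<Phi> (h, \<sigma> g) * v j g = 0" using v0[of g j] B(2) that by (cases "g \<in> ?A") auto
  qed
  then have "B \<subseteq> {h\<in>H. \<forall>j\<in>J. h \<in> zero_set H (mat_mult G \<sigma> \<Phi> (v j))}"
    using BH by (auto simp: zero_set_def)
  then have "{h\<in>H. \<forall>j\<in>J. h \<in> zero_set H (mat_mult G \<sigma> \<Phi> (v j))} \<in> \<HH>"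
    by (rule filter_on_upward[OF balanced_filter_on[OF H] B(1)]) blast
  then show "has_filter_sum H \<HH> J (\<lambda>j. mat_mult G \<sigma> \<Phi> (v j)) (mat_mult G \<sigma> \<Phi> f)"
    unfolding has_filter_sum_def has_tych_sum_def
    using row mat_mult_functions_on[OF \<Phi>] by auto
qed

end

lemma row_in_Funct_star_iff:
  assumes "h \<in> H"
  shows "(\<lambda>g. \<Phi> (h, g)) \<in> Funct G (star_filter \<sigma> (perp G \<GG>)) \<longleftrightarrow>
    zero_set G (\<lambda>g. \<Phi> (h, \<sigma> g)) \<in> perp G \<GG>"
proof -
  have \<sigma>: "\<sigma> g \<in> G" "\<sigma> (\<sigma> g) = g" if "g \<in> G" for g
    using inv that unfolding involution_on_def by auto
  have "\<sigma> ` zero_set G (\<lambda>g. \<Phi> (h, g)) = zero_set G (\<lambda>g. \<Phi> (h, \<sigma> g))"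
    using \<sigma> by (force simp: zero_set_def)
  moreover have "perp G \<GG> \<subseteq> Pow G" by (auto simp: perp_def)
  moreover have "(\<lambda>g. \<Phi> (h, g)) \<in> functions_on G" using \<Phi> by (simp add: functions_on_def)
  moreover have "zero_set G (\<lambda>g. \<Phi> (h, g)) \<subseteq> G" by (auto simp: zero_set_def)
  ultimately show ?thesis
    by (simp add: Funct_def star_filter_iff[OF inv])
qed

text \<open>
  The families \<open>\<delta>\<^sup>t k\<^sub>t\<close> indexed by the complement of some \<open>A \<in> \<GG>\<close> are summable, and their images are the
  multiples \<open>\<Phi>\<^bsup>t*\<^esup> k\<^sub>t\<close> of the columns. That only finitely many of these are nonzero at a given \<open>h\<close>, for
  each \<open>A\<close>, is membership of the row in the dual filter.
\<close>

lemma filter_linear_imp_summable: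
  assumes lin: "mult_filter_linear TYPE('g) G \<sigma> \<GG> H \<HH> \<Phi>"
  shows "rows_and_columns_summable G \<sigma> \<GG> H \<HH> \<Phi>"
proof -
  have map: "mult_defines_map G \<sigma> \<GG> H \<HH> \<Phi>"
    using lin by (simp add: mult_filter_linear_def)
  have sums: "\<exists>a. has_tych_sum G (G - A) (\<lambda>t g. delta t g * k t) a \<and>
      mult_defined H G \<sigma> \<Phi> a \<and>
      has_filter_sum H \<HH> (G - A) (\<lambda>t h. \<Phi> (h, \<sigma> t) * k t) (mat_mult G \<sigma> \<Phi> a)"
    if A: "A \<in> \<GG>" for A and k :: "'g \<Rightarrow> 'k"
  proof -
    let ?v = "\<lambda>t g. delta t g * k t" and ?a = "\<lambda>g. if g \<in> G - A then k g else 0"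
    have AG: "A \<subseteq> G" by (rule filter_on_subset[OF balanced_filter_on[OF G] A])
    have a: "?a \<in> Funct G \<GG>"
      by (rule FunctI[OF balanced_filter_on[OF G] _ A]) (auto simp: functions_on_def)
    have tych: "has_tych_sum G (G - A) ?v ?a" by (rule has_tych_sum_delta) blast
    have "{s\<in>G. \<forall>t\<in>G - A. s \<in> zero_set G (?v t)} \<in> \<GG>"
      by (rule filter_on_upward[OF balanced_filter_on[OF G] A])
        (use AG in \<open>auto simp: zero_set_def delta_def\<close>)
    then have sum: "has_filter_sum G \<GG> (G - A) ?v ?a"
      using tych by (simp add: has_filter_sum_def)
    have v: "?v t \<in> Funct G \<GG>" if "t \<in> G - A" for t
      by (rule delta_in_Funct[OF G]) (use that in simp)
    have "filter_linear TYPE('g) G \<GG> H \<HH> (mat_mult G \<sigma> \<Phi>)"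
      using lin by (simp add: mult_filter_linear_def)
    then have
      "has_filter_sum H \<HH> (G - A) (\<lambda>t. mat_mult G \<sigma> \<Phi> (?v t)) (mat_mult G \<sigma> \<Phi> ?a)"
      using v sum by (rule filter_linear_sum[where v = ?v])
    moreover have "mat_mult G \<sigma> \<Phi> (?v t) = (\<lambda>h. \<Phi> (h, \<sigma> t) * k t)" if "t \<in> G - A" for t
      by (rule mat_mult_delta) (use that in blast)
    ultimately have "has_filter_sum H \<HH> (G - A) (\<lambda>t h. \<Phi> (h, \<sigma> t) * k t) (mat_mult G \<sigma> \<Phi> ?a)"
      by (simp add: has_filter_sum_def has_tych_sum_def cong: conj_cong)
    moreover have "mult_defined H G \<sigma> \<Phi> ?a"
      using map a by (simp add: mult_defines_map_def)
    ultimately show ?thesis by (intro exI[of _ ?a] conjI tych)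
  qed
  have columns: "filter_summable H \<HH> (G - A) (\<lambda>t h. \<Phi> (h, \<sigma> t))" if "A \<in> \<GG>" for A
    using sums[OF that, of "\<lambda>t. 1"] by (auto simp: filter_summable_def)
  have rows: "(\<lambda>g. \<Phi> (h, g)) \<in> Funct G (star_filter \<sigma> (perp G \<GG>))" if h: "h \<in> H" for h
    unfolding row_in_Funct_star_iff[OF h] unfolding perp_def
  proof (intro CollectI conjI ballI)
    fix A assume "A \<in> \<GG>"
    then have "finite {t\<in>G - A. \<Phi> (h, \<sigma> t) \<noteq> 0}"
      using columns h unfolding filter_summable_def has_filter_sum_def has_tych_sum_def by blast
    then show "finite (G - (zero_set G (\<lambda>g. \<Phi> (h, \<sigma> g)) \<union> A))"
      by (rule rev_finite_subset) (auto simp: zero_set_def)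
  qed (auto simp: zero_set_def)
  show ?thesis
    unfolding rows_and_columns_summable_def
    by (intro conjI ballI allI rows columns sums)
qed

text \<open>
  Here the transposition lemma is applied with rows and columns interchanged and to the dual filters,
  whose duals are \<open>\<GG>\<close> and \<open>\<HH>\<close> again.
\<close>

lemma summable_imp_zero_set:
  assumes sum: "rows_and_columns_summable G \<sigma> \<GG> H \<HH> \<Phi>"
  shows "zero_set_in_pair_filter G \<sigma> \<GG> H \<HH> \<Phi>"
proof -
  have vanish: "vanishes_on_rectangles \<HH> G \<GG> (\<lambda>h g. \<Phi> (h, \<sigma> g))"
    unfolding vanishes_on_rectangles_def
  proof
    fix A assume "A \<in> \<GG>"
    then have "{h\<in>H. \<forall>t\<in>G - A. h \<in> zero_set H (\<lambda>h. \<Phi> (h, \<sigma> t))} \<in> \<HH>"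
      using sum unfolding rows_and_columns_summable_def filter_summable_def has_filter_sum_def
      by blast
    then show "\<exists>B\<in>\<HH>. \<forall>h\<in>B. \<forall>g\<in>G - A. \<Phi> (h, \<sigma> g) = 0"
      by (rule rev_bexI) (auto simp: zero_set_def)
  qed
  have "zero_set G (\<lambda>g. \<Phi> (h, \<sigma> g)) \<in> perp G \<GG>" if "h \<in> H" for h
    using sum row_in_Funct_star_iff[OF that] that unfolding rows_and_columns_summable_def by blast
  moreover have "vanishes_on_rectangles (perp H (perp H \<HH>)) G (perp G (perp G \<GG>))
      (\<lambda>h g. \<Phi> (h, \<sigma> g))"
    unfolding balanced_perp_perp[OF G] balanced_perp_perp[OF H] by (rule vanish)
  ultimately have "vanishes_on_rectangles (perp G \<GG>) H (perp H \<HH>) (\<lambda>g h. \<Phi> (h, \<sigma> g))"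
    by (rule vanishes_on_rectangles_transpose[OF balanced_perp[OF G]])
  with vanish show ?thesis by (simp add: zero_set_in_pair_filter_iff[OF inv G H])
qed

end

section \<open>Independence of the index type\<close>

lemma has_tych_sum_reindex:
  assumes "inj_on e I"
  shows "has_tych_sum S (e ` I) v f \<longleftrightarrow> has_tych_sum S I (\<lambda>i. v (e i)) f"
proof -
  have eq: "{j \<in> e ` I. v j s \<noteq> 0} = e ` {i\<in>I. v (e i) s \<noteq> 0}" for s by auto
  have inj: "inj_on e {i\<in>I. v (e i) s \<noteq> 0}" for s
    by (rule inj_on_subset[OF assms]) blast
  show ?thesis
    unfolding has_tych_sum_def eq finite_image_iff[OF inj] sum.reindex[OF inj] by (simp add: o_def)
qed

lemma has_filter_sum_reindex:
  assumes "inj_on e I"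
  shows "has_filter_sum S F (e ` I) v f \<longleftrightarrow> has_filter_sum S F I (\<lambda>i. v (e i)) f"
  unfolding has_filter_sum_def has_tych_sum_reindex[OF assms] by simp

text \<open>
  Recovering the columns of a matrix from its multiplication map uses families indexed by \<open>'g\<close>; an
  injection of \<open>'g\<close> into another index type turns them into families over that type.
\<close>

lemma filter_linear_reindex:
  fixes e :: "'i \<Rightarrow> 'j" and \<phi> :: "('g \<Rightarrow> 'k::division_ring) \<Rightarrow> 'h \<Rightarrow> 'k"
  assumes e: "inj e" and lin: "filter_linear TYPE('j) G \<GG> H \<HH> \<phi>"
  shows "filter_linear TYPE('i) G \<GG> H \<HH> \<phi>"
  unfolding filter_linear_def
proof (intro conjI allI impI)
  show "right_linear G \<GG> H \<HH> \<phi>" using lin by (simp add: filter_linear_def)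
next
  fix I :: "'i set" and v :: "'i \<Rightarrow> 'g \<Rightarrow> 'k" and f
  assume "(\<forall>i\<in>I. v i \<in> Funct G \<GG>) \<and> has_filter_sum G \<GG> I v f"
  moreover have inj: "inj_on e I" by (rule inj_on_subset[OF e]) blast
  ultimately have "\<And>j. j \<in> e ` I \<Longrightarrow> v (inv e j) \<in> Funct G \<GG>"
      and "has_filter_sum G \<GG> (e ` I) (\<lambda>j. v (inv e j)) f"
    by (auto simp: has_filter_sum_reindex inv_f_f[OF e])
  then have "has_filter_sum H \<HH> (e ` I) (\<lambda>j. \<phi> (v (inv e j))) (\<phi> f)"
    by (rule filter_linear_sum[OF lin])
  then show "has_filter_sum H \<HH> I (\<lambda>i. \<phi> (v i)) (\<phi> f)"
    by (simp add: has_filter_sum_reindex[OF inj] inv_f_f[OF e])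
qed

section \<open>The matrix of a continuous linear map\<close>

lemma matrix_of_entry:
  assumes "involution_on G \<sigma>" "g \<in> G" "h \<in> H"
  shows "matrix_of H G \<sigma> \<phi> (h, \<sigma> g) = \<phi> (delta g) h"
  using assms by (auto simp: matrix_of_def involution_on_def)

lemma matrix_of_functions_on: "matrix_of H G \<sigma> \<phi> \<in> functions_on (H \<times> G)"
  by (auto simp: matrix_of_def functions_on_def)

lemma matrix_of_zero_set:
  fixes \<phi> :: "('g \<Rightarrow> 'k::division_ring) \<Rightarrow> 'h \<Rightarrow> 'k"
  assumes "involution_on G \<sigma>" "balanced G \<GG>" "balanced H \<HH>" "right_linear G \<GG> H \<HH> \<phi>"
    and "continuous_map (filter_topology G \<GG>) (filter_topology H \<HH>) \<phi>"
  shows "zero_set_in_pair_filter G \<sigma> \<GG> H \<HH> (matrix_of H G \<sigma> \<phi>)"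
  by (rule continuous_right_linear_zero_set[OF assms]) (rule matrix_of_entry[OF assms(1)])

text \<open>
  Fix a coordinate \<open>h\<close>. By continuity it vanishes on the image of some basic neighbourhood, given by
  \<open>A\<close> in the dual filter. The support of a column \<open>a\<close> is almost contained in \<open>A\<close>, so \<open>a\<close> is the sum of a
  column with finite support, where linearity suffices, and of a column in that neighbourhood.
\<close>

lemma matrix_of_mult:
  fixes \<phi> :: "('g \<Rightarrow> 'k::division_ring) \<Rightarrow> 'h \<Rightarrow> 'k"
  assumes inv: "involution_on G \<sigma>" and G: "balanced G \<GG>" and H: "balanced H \<HH>"
    and lin: "right_linear G \<GG> H \<HH> \<phi>"
    and cont: "continuous_map (filter_topology G \<GG>) (filter_topology H \<HH>) \<phi>"
    and a: "a \<in> Funct G \<GG>"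
  shows "\<phi> a = mat_mult G \<sigma> (matrix_of H G \<sigma> \<phi>) a"
proof
  fix h
  show "\<phi> a h = mat_mult G \<sigma> (matrix_of H G \<sigma> \<phi>) a h"
  proof (cases "h \<in> H")
    case False
    have "\<phi> a \<in> functions_on H"
      using right_linear_Funct[OF lin a] by (simp add: Funct_def)
    then show ?thesis
      using False mat_mult_functions_on[OF matrix_of_functions_on[of H G \<sigma> \<phi>], of \<sigma> a]
      by (simp add: functions_on_def)
  next
    case True
    have "H - {h} \<in> perp H \<HH>" by (rule perp_cofinite) simp
    then obtain A where A: "A \<in> perp G \<GG>" "\<phi> ` basic_nhd G \<GG> A \<subseteq> basic_nhd H \<HH> (H - {h})"
      using cont continuous_right_linear_iff[OF balanced_filter_on[OF G] balanced_filter_on[OF H] lin]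
      by blast
    have small: "\<phi> u h = 0" if "u \<in> basic_nhd G \<GG> A" for u
      using A(2) that True by (auto simp: basic_nhd_def supp_def)
    have aG: "a \<in> functions_on G" "zero_set G a \<in> \<GG>" using a by (auto simp: Funct_def)
    have AG: "A \<subseteq> G" using A(1) by (simp add: perp_def)
    define E where "E = G - (A \<union> zero_set G a)"
    have E: "finite E" "E \<subseteq> G" unfolding E_def using perp_finite[OF A(1) aG(2)] by auto
    let ?b = "\<lambda>g. if g \<in> E then a g else 0" and ?u = "\<lambda>g. if g \<in> A then a g else 0"
    have b: "?b \<in> Funct G \<GG>" by (rule Funct_finite_support[OF G E]) auto
    have "?u \<in> Funct G \<GG>"
      by (rule FunctI[OF balanced_filter_on[OF G] _ aG(2)])
        (use AG in \<open>auto simp: functions_on_def zero_set_def\<close>)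
    then have u: "?u \<in> basic_nhd G \<GG> A" by (auto simp: basic_nhd_def supp_def)
    have split: "a = (\<lambda>g. ?b g + ?u g)"
    proof
      fix g
      show "a g = ?b g + ?u g"
        using aG(1) by (cases "g \<in> A") (auto simp: E_def zero_set_def functions_on_def)
    qed
    have "\<phi> a = \<phi> (\<lambda>g. ?b g + ?u g)" by (rule arg_cong[OF split])
    also have "\<dots> = (\<lambda>h. \<phi> ?b h + \<phi> ?u h)"
      by (rule right_linear_add[OF lin b \<open>?u \<in> Funct G \<GG>\<close>])
    finally have "\<phi> a = (\<lambda>h. \<phi> ?b h + \<phi> ?u h)" .
    then have "\<phi> a h = \<phi> ?b h" using small[OF u] by simp
    also have "\<dots> = (\<Sum>g\<in>E. \<phi> (delta g) h * a g)"
      by (simp add: right_linear_finite_support[OF G lin E])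
    also have "\<dots> = (\<Sum>g\<in>E. matrix_of H G \<sigma> \<phi> (h, \<sigma> g) * a g)"
      using E(2) by (intro sum.cong) (auto simp: matrix_of_entry[OF inv _ True])
    also have "\<dots> = mat_mult G \<sigma> (matrix_of H G \<sigma> \<phi>) a h"
    proof (rule mat_mult_eq_sum[OF E, symmetric])
      fix g assume g: "g \<in> G - E"
      show "matrix_of H G \<sigma> \<phi> (h, \<sigma> g) * a g = 0"
      proof (cases "g \<in> A")
        case True
        then show ?thesis
          using small[OF delta_in_basic_nhd[OF G True AG]] g
          by (simp add: matrix_of_entry[OF inv _ \<open>h \<in> H\<close>])
      next
        case False
        then show ?thesis using g by (auto simp: E_def zero_set_def)
      qed
    qed
    finally show ?thesis .
  qed
qed

section \<open>The equivalence\<close>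

lemma filter_linear_imp_zero_set:
  assumes "involution_on G \<sigma>" "balanced G \<GG>" "balanced H \<HH>" "\<Phi> \<in> functions_on (H \<times> G)"
    and lin: "mult_filter_linear TYPE('g \<times> nat) G \<sigma> \<GG> H \<HH> \<Phi>"
  shows "zero_set_in_pair_filter (G :: 'g set) \<sigma> \<GG> H \<HH> \<Phi>"
proof -
  have "inj (\<lambda>g :: 'g. (g, 0 :: nat))" by (rule injI) simp
  then have "mult_filter_linear TYPE('g) G \<sigma> \<GG> H \<HH> \<Phi>"
    using lin filter_linear_reindex unfolding mult_filter_linear_def by blast
  then show ?thesis
    using assms(1-4) filter_linear_imp_summable summable_imp_zero_set by blast
qed

theorem theorem9p6:
  fixes G :: "'g set" and H :: "'h set"
    and \<sigma> :: "'g \<Rightarrow> 'g" and \<tau> :: "'h \<Rightarrow> 'h"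
    and \<GG> :: "'g set set" and \<HH> :: "'h set set"
    and \<Phi> :: "'h \<times> 'g \<Rightarrow> 'k::division_ring"
  assumes "involution_on G \<sigma>" and "involution_on H \<tau>"
    and "balanced G \<GG>" and "balanced H \<HH>"
    and "\<Phi> \<in> functions_on (H \<times> G)"
  shows
    "(mult_continuous_linear G \<sigma> \<GG> H \<HH> \<Phi> \<longleftrightarrow> zero_set_in_pair_filter G \<sigma> \<GG> H \<HH> \<Phi>) \<and>
     (zero_set_in_pair_filter G \<sigma> \<GG> H \<HH> \<Phi> \<longleftrightarrow> rows_and_columns_summable G \<sigma> \<GG> H \<HH> \<Phi>) \<and>
     (rows_and_columns_summable G \<sigma> \<GG> H \<HH> \<Phi> \<longleftrightarrow>
        mult_filter_linear TYPE('g \<times> nat) G \<sigma> \<GG> H \<HH> \<Phi>) \<and>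
     (mult_filter_linear TYPE('g \<times> nat) G \<sigma> \<GG> H \<HH> \<Phi> \<longrightarrow>
        mult_filter_linear TYPE('j) G \<sigma> \<GG> H \<HH> \<Phi>) \<and>
     (\<forall>\<phi> :: ('g \<Rightarrow> 'k) \<Rightarrow> ('h \<Rightarrow> 'k).
        right_linear G \<GG> H \<HH> \<phi> \<and>
        continuous_map (filter_topology G \<GG>) (filter_topology H \<HH>) \<phi> \<longrightarrow>
        (\<forall>a\<in>Funct G \<GG>. \<phi> a = mat_mult G \<sigma> (matrix_of H G \<sigma> \<phi>) a) \<and>
        mult_continuous_linear G \<sigma> \<GG> H \<HH> (matrix_of H G \<sigma> \<phi>) \<and>
        zero_set_in_pair_filter G \<sigma> \<GG> H \<HH> (matrix_of H G \<sigma> \<phi>) \<and>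
        rows_and_columns_summable G \<sigma> \<GG> H \<HH> (matrix_of H G \<sigma> \<phi>) \<and>
        mult_filter_linear TYPE('g \<times> nat) G \<sigma> \<GG> H \<HH> (matrix_of H G \<sigma> \<phi>) \<and>
        mult_filter_linear TYPE('j) G \<sigma> \<GG> H \<HH> (matrix_of H G \<sigma> \<phi>))"
proof -
  have equiv: "(mult_continuous_linear G \<sigma> \<GG> H \<HH> M \<longleftrightarrow> zero_set_in_pair_filter G \<sigma> \<GG> H \<HH> M) \<and>
     (zero_set_in_pair_filter G \<sigma> \<GG> H \<HH> M \<longleftrightarrow> rows_and_columns_summable G \<sigma> \<GG> H \<HH> M) \<and>
     (rows_and_columns_summable G \<sigma> \<GG> H \<HH> M \<longleftrightarrow>
        mult_filter_linear TYPE('g \<times> nat) G \<sigma> \<GG> H \<HH> M) \<and>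
     (mult_filter_linear TYPE('g \<times> nat) G \<sigma> \<GG> H \<HH> M \<longrightarrow>
        mult_filter_linear TYPE('j) G \<sigma> \<GG> H \<HH> M)"
    if M: "M \<in> functions_on (H \<times> G)" for M :: "'h \<times> 'g \<Rightarrow> 'k"
  proof -
    note setting = assms(1,3,4) M
    show ?thesis
      using continuous_imp_zero_set[OF setting] zero_set_imp_continuous[OF setting]
        zero_set_imp_filter_linear[OF setting, where 'j = 'g]
        zero_set_imp_filter_linear[OF setting, where 'j = "'g \<times> nat"]
        zero_set_imp_filter_linear[OF setting, where 'j = 'j]
        filter_linear_imp_summable[OF setting] summable_imp_zero_set[OF setting]
        filter_linear_imp_zero_set[OF setting]
      by blast
  qed
  show ?thesis
    using equiv[OF assms(5)] equiv[OF matrix_of_functions_on]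
      matrix_of_zero_set[OF assms(1,3,4)] matrix_of_mult[OF assms(1,3,4)]
    by blast
qed

end
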